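(* Assume $\phi'(y)\ne0$ for all $y\in\mathbb{R}$, and let $\omega>0$. Consider the time-optimal relocation problem: given $\tilde x,\hat x\in\mathbb{R}^{2n}$, steer the system $\dot x=f(x)+g^u(x)u+g^v(x)v$, $g^u=\frac{\partial}{\partial p_1}$, $g^v=\frac{\partial}{\partial p_n}$, from $x(0)=\tilde x$ to $x(T)=\hat x$ in minimal time $T>0$ by controls satisfying $u(t)\in[-\omega,\omega]$, $v(t)\in[-\omega,0]$. Then every optimal control of this problem is bang-bang and possesses a finite number of switchings.
   Context: Let $n\ge 2$. $\Phi:\mathbb{R}\to\mathbb{R}$ is a real analytic, bounded below function with $\lim_{y\to+\infty}\Phi(y)=+\infty$, and $\phi=\Phi'$. The state is $x=(q,p)=(q_1,\dots,q_n,p_1,\dots,p_n)\in\mathbb{R}^{2n}$. The drift is the vector field $$f=\sum_{k=1}^{n}p_k\frac{\partial}{\partial q_k}-\phi(q_1-q_2)\frac{\partial}{\partial p_1}+\sum_{k=2}^{n-1}\bigl(\phi(q_{k-1}-q_k)-\phi(q_k-q_{k+1})\bigr)\frac{\partial}{\partial p_k}+\phi(q_{n-1}-q_n)\frac{\partial}{\partial p_n}.$$ Admissible controls are measurable functions $t\mapsto(u(t),v(t))$ with values in the rectangle $[-\omega,\omega]\times[-\omega,0]$. A control is bang-bang if for almost every $t\in[0,T]$ its value is a vertex of this rectangle. A switching is a change of the value of the control from one vertex to another. Thus a bang-bang control with finitely many switchings is, up to modification on a null set, piecewise constant with finitely many pieces and vertex values. *)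

theory Defs
  imports "HOL-Analysis.Analysis"
begin

definition real_analytic :: "(real \<Rightarrow> real) \<Rightarrow> bool" where
  "real_analytic F \<longleftrightarrow>
     (\<forall>z. \<exists>r>0. \<exists>a. \<forall>y. \<bar>y - z\<bar> < r \<longrightarrow> (\<lambda>k. a k * (y - z) ^ k) sums F y)"

text \<open>
  The number \<open>n\<close> of particles is the cardinality of the finite index type \<open>'n\<close>, which carries no
  order; a labelling \<open>\<iota>\<close> names its elements \<open>\<iota> 1, \<dots>, \<iota> n\<close>. The state is \<open>x = (q, p)\<close> with
  \<open>q\<^sub>k = fst x $ \<iota> k\<close> and \<open>p\<^sub>k = snd x $ \<iota> k\<close>.
\<close>

type_synonym 'n state = "(real ^ 'n) \<times> (real ^ 'n)"

definition labelling :: "nat \<Rightarrow> (nat \<Rightarrow> 'n::finite) \<Rightarrow> bool" where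
  "labelling n \<iota> \<longleftrightarrow> bij_betw \<iota> {1..n} UNIV"

definition dq :: "(nat \<Rightarrow> 'n::finite) \<Rightarrow> nat \<Rightarrow> 'n state" where
  "dq \<iota> k = (axis (\<iota> k) 1, 0)"

definition dp :: "(nat \<Rightarrow> 'n::finite) \<Rightarrow> nat \<Rightarrow> 'n state" where
  "dp \<iota> k = (0, axis (\<iota> k) 1)"

definition drift :: "nat \<Rightarrow> (nat \<Rightarrow> 'n::finite) \<Rightarrow> (real \<Rightarrow> real) \<Rightarrow> 'n state \<Rightarrow> 'n state" where
  "drift n \<iota> \<phi> x =
     (let q = (\<lambda>k. fst x $ \<iota> k); p = (\<lambda>k. snd x $ \<iota> k) in
       (\<Sum>k=1..n. p k *\<^sub>R dq \<iota> k)
       - \<phi> (q 1 - q 2) *\<^sub>R dp \<iota> 1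
       + (\<Sum>k=2..n-1. (\<phi> (q (k - 1) - q k) - \<phi> (q k - q (k + 1))) *\<^sub>R dp \<iota> k)
       + \<phi> (q (n - 1) - q n) *\<^sub>R dp \<iota> n)"

definition g_u :: "nat \<Rightarrow> (nat \<Rightarrow> 'n::finite) \<Rightarrow> 'n state \<Rightarrow> 'n state" where
  "g_u n \<iota> x = dp \<iota> 1"

definition g_v :: "nat \<Rightarrow> (nat \<Rightarrow> 'n::finite) \<Rightarrow> 'n state \<Rightarrow> 'n state" where
  "g_v n \<iota> x = dp \<iota> n"

definition admissible_control :: "real \<Rightarrow> real \<Rightarrow> (real \<Rightarrow> real) \<Rightarrow> (real \<Rightarrow> real) \<Rightarrow> bool" where
  "admissible_control \<omega> T u v \<longleftrightarrow>
     u \<in> borel_measurable (lebesgue_on {0..T}) \<and> v \<in> borel_measurable (lebesgue_on {0..T}) \<and>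
     (\<forall>t\<in>{0..T}. (u t, v t) \<in> {-\<omega>..\<omega>} \<times> {-\<omega>..0})"

text \<open>
  Caratheodory solutions, by the equivalent integral equation. It makes \<open>x\<close> continuous on
  \<open>{0..T}\<close>, so for a continuous \<open>\<phi>\<close> and an admissible control the integrand is bounded and
  measurable: the integral is then the Lebesgue integral and \<open>x\<close> is absolutely continuous.
\<close>

definition trajectory ::
  "nat \<Rightarrow> (nat \<Rightarrow> 'n::finite) \<Rightarrow> (real \<Rightarrow> real) \<Rightarrow> real \<Rightarrow> (real \<Rightarrow> real) \<Rightarrow> (real \<Rightarrow> real)
    \<Rightarrow> (real \<Rightarrow> 'n state) \<Rightarrow> bool" where
  "trajectory n \<iota> \<phi> T u v x \<longleftrightarrow>
     (\<forall>t\<in>{0..T}.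
        ((\<lambda>s. drift n \<iota> \<phi> (x s) + u s *\<^sub>R g_u n \<iota> (x s) + v s *\<^sub>R g_v n \<iota> (x s))
           has_integral (x t - x 0)) {0..t})"

definition steers ::
  "nat \<Rightarrow> (nat \<Rightarrow> 'n::finite) \<Rightarrow> (real \<Rightarrow> real) \<Rightarrow> real \<Rightarrow> 'n state \<Rightarrow> 'n state
    \<Rightarrow> real \<Rightarrow> (real \<Rightarrow> real) \<Rightarrow> (real \<Rightarrow> real) \<Rightarrow> bool" where
  "steers n \<iota> \<phi> \<omega> a b T u v \<longleftrightarrow>
     0 < T \<and> admissible_control \<omega> T u v \<and>
     (\<exists>x. trajectory n \<iota> \<phi> T u v x \<and> x 0 = a \<and> x T = b)"

definition time_optimal ::
  "nat \<Rightarrow> (nat \<Rightarrow> 'n::finite) \<Rightarrow> (real \<Rightarrow> real) \<Rightarrow> real \<Rightarrow> 'n state \<Rightarrow> 'n state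
    \<Rightarrow> real \<Rightarrow> (real \<Rightarrow> real) \<Rightarrow> (real \<Rightarrow> real) \<Rightarrow> bool" where
  "time_optimal n \<iota> \<phi> \<omega> a b T u v \<longleftrightarrow>
     steers n \<iota> \<phi> \<omega> a b T u v \<and>
     (\<forall>T' u' v'. steers n \<iota> \<phi> \<omega> a b T' u' v' \<longrightarrow> T \<le> T')"

definition bang_bang :: "real \<Rightarrow> real \<Rightarrow> (real \<Rightarrow> real) \<Rightarrow> (real \<Rightarrow> real) \<Rightarrow> bool" where
  "bang_bang \<omega> T u v \<longleftrightarrow>
     (AE t in lebesgue_on {0..T}. (u t, v t) \<in> {-\<omega>, \<omega>} \<times> {-\<omega>, 0})"

text \<open>
  Up to modification on a null set, \<open>(u, v)\<close> is constant on the pieces of a finite partition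
  \<open>0 = \<tau> 0 < \<dots> < \<tau> N = T\<close>; for a bang-bang control the values \<open>w i\<close> are then vertices.
\<close>

definition finitely_many_switchings :: "real \<Rightarrow> (real \<Rightarrow> real) \<Rightarrow> (real \<Rightarrow> real) \<Rightarrow> bool" where
  "finitely_many_switchings T u v \<longleftrightarrow>
     (\<exists>(N::nat) (\<tau>::nat \<Rightarrow> real) (w::nat \<Rightarrow> real \<times> real).
        \<tau> 0 = 0 \<and> \<tau> N = T \<and> (\<forall>i<N. \<tau> i < \<tau> (Suc i)) \<and>
        (\<forall>i<N. AE t in lebesgue_on {\<tau> i..\<tau> (Suc i)}. (u t, v t) = w i))"

end

theory Submission
  imports Defs
begin

text \<open>
  A time-optimal control satisfies the maximum condition of Pontryagin's principle for some
  nowhere vanishing adjoint vector. Since the controls enter affinely and range over a convex set,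
  no needle variations are needed: if the endpoints of the linearised system under the convex
  variations \<open>h + \<alpha> (w - h)\<close> filled a neighbourhood of the origin, Brouwer's theorem would
  produce a control reaching the target strictly earlier, so these endpoints lie in a half space.

  Let \<open>b k\<close> be the component of the adjoint vector dual to \<open>p\<^sub>k\<close>. The maximum condition says that the
  signs of \<open>b 1\<close> and \<open>b n\<close> determine \<open>u\<close> and \<open>v\<close> wherever these functions do not vanish. The adjoint
  equation is the linearised chain
  \<open>b k'' = \<psi> (k - 1) (b (k - 1) - b k) - \<psi> k (b k - b (k + 1))\<close> with continuous, nowhere vanishing
  \<open>\<psi> k\<close>, the value of \<open>\<phi>'\<close> at the \<open>k\<close>-th bond. At any time some \<open>b k\<close> vanishes to order at most one, and the order of
  vanishing grows by two with each step towards the end of the chain, so the zeros of \<open>b 1\<close> and \<open>b n\<close>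
  are isolated, hence finite in number.
\<close>

section \<open>Differential equations with measurable controls\<close>

text \<open>The forward linearised equation is never solved. By duality, the coordinate of its
  endpoint along a basis vector \<open>e\<close> is the integral of the control variation against
  the adjoint solution with terminal value \<open>e\<close>, so only backward equations occur. The
  duality is an exact identity for the difference of two nonlinear trajectories; its remainder is
  the linearisation error, which is then estimated directly. The varied endpoint depends on the
  parameters only Lipschitz continuously, because the coefficients of the variations are positive
  and negative parts. This is why Brouwer's theorem stands where an inverse function theorem might
  be expected. Stopping a little early is just another small perturbation of the endpoint map, so no
  separate multiplier for time has to be tracked. A C1 field need not be globally Lipschitz. Varied
  trajectories are therefore built for a field clamped outside a ball, and those that matter are
  shown to stay where the two fields agree.\<close>

lemma nonpos_deriv_within_imp_le:
  fixes g g' :: "real \<Rightarrow> real"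
  assumes "a \<le> b"
    and der: "\<And>t. t \<in> {a..b} \<Longrightarrow> (g has_real_derivative g' t) (at t within {a..b})"
    and neg: "\<And>t. t \<in> {a..b} \<Longrightarrow> g' t \<le> 0"
  shows "g b \<le> g a"
proof -
  have "\<exists>x\<in>{a..b}. g b - g a = (\<lambda>h. g' x * h) (b - a)"
    by (rule mvt_very_simple[OF \<open>a \<le> b\<close>]) (use der in \<open>auto simp: has_field_derivative_def\<close>)
  then obtain x where "x \<in> {a..b}" "g b - g a = g' x * (b - a)"
    by auto
  with neg[of x] \<open>a \<le> b\<close> show ?thesis
    by (metis diff_ge_0_iff_ge diff_le_0_iff_le mult_nonpos_nonneg)
qed

lemma gronwall:
  fixes g :: "real \<Rightarrow> real"
  assumes cont: "continuous_on {0..T} g" and "0 \<le> L"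
    and le: "\<And>t. t \<in> {0..T} \<Longrightarrow> g t \<le> c + L * integral {0..t} g"
    and t: "t \<in> {0..T}"
  shows "g t \<le> c * exp (L * t)"
proof -
  \<comment> \<open>With this integrating factor the derivative of \<gamma> is a nonnegative
    multiple of \<open>g s - (c + L * integral {0..s} g)\<close>, so \<gamma> cannot
    increase.\<close>
  define \<gamma> where "\<gamma> s = exp (- L * s) * (c + L * integral {0..s} g)" for s
  have "(\<gamma> has_real_derivative exp (- L * s) * (L * (g s - (c + L * integral {0..s} g))))
      (at s within {0..T})" if "s \<in> {0..T}" for s
    unfolding \<gamma>_def
    by (auto intro!: derivative_eq_intros integral_has_real_derivative[OF cont that] simp: algebra_simps)
  then have "(\<gamma> has_real_derivative exp (- L * s) * (L * (g s - (c + L * integral {0..s} g))))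
      (at s within {0..t})" if "s \<in> {0..t}" for s
    using that t by (meson DERIV_subset atLeastAtMost_iff atLeastatMost_subset_iff order.trans order_refl)
  then have "\<gamma> t \<le> \<gamma> 0"
    by (rule nonpos_deriv_within_imp_le[rotated])
      (use le t \<open>0 \<le> L\<close> in \<open>auto intro!: mult_nonneg_nonpos\<close>)
  then have "c + L * integral {0..t} g \<le> c * exp (L * t)"
    by (simp add: \<gamma>_def exp_minus field_simps)
  with le[OF t] show ?thesis by simp
qed

text \<open>The integral operator becomes a contraction on the whole interval at once when functions
  are weighted by \<open>exp (- K * t)\<close>: integrating \<open>L * exp (K * s)\<close> gains the
  factor \<open>L / K < 1\<close>. No gluing of local solutions is required.\<close>

lemma picard_lindelof_global:
  fixes F :: "real \<Rightarrow> 'a::euclidean_space \<Rightarrow> 'a"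
  assumes T: "0 \<le> T" and L: "0 \<le> L"
    and cont: "continuous_on ({0..T} \<times> UNIV) (\<lambda>(t, y). F t y)"
    and lip: "\<And>t y z. t \<in> {0..T} \<Longrightarrow> norm (F t y - F t z) \<le> L * norm (y - z)"
  obtains y where "y 0 = y0"
    and "\<And>t. t \<in> {0..T} \<Longrightarrow> (y has_vector_derivative F t (y t)) (at t within {0..T})"
proof -
  \<comment> \<open>Adding 1 keeps \<open>K\<close> positive and \<open>L / K\<close> below 1 even
    for \<open>L = 0\<close>.\<close>
  define K where "K = L + 1"
  have "0 < K" using L by (simp add: K_def)
  define I where "I z t = y0 + integral {0..t} (\<lambda>s. F s (exp (K * s) *\<^sub>R z s))" for z t
  \<comment> \<open>Clamping time extends functions on \<open>{0..T}\<close> to bounded continuous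
    functions on the whole line, which form a complete metric type to which Banach's theorem
    applies.\<close>
  define c where "c t = max 0 (min T t)" for t
  have c: "c t \<in> {0..T}" "t \<in> {0..T} \<Longrightarrow> c t = t" for t
    using T by (auto simp: c_def)
  have cont_c: "continuous_on UNIV c"
    unfolding c_def by (intro continuous_intros)
  have contF: "continuous_on {0..T} (\<lambda>s. F s (exp (K * s) *\<^sub>R z s))"
    if "continuous_on {0..T} z" for z
    by (rule continuous_on_compose2[OF cont, where f = "\<lambda>s. (s, exp (K * s) *\<^sub>R z s)", simplified])
      (auto intro!: continuous_intros that)
  have dI: "(I z has_vector_derivative F t (exp (K * t) *\<^sub>R z t)) (at t within {0..T})"
    if "continuous_on {0..T} z" "t \<in> {0..T}" for z t
    unfolding I_def by (auto intro!: derivative_eq_intros integral_has_vector_derivative contF that)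
  define P where "P z t = exp (- K * c t) *\<^sub>R I z (c t)" for z t
  have P: "P z \<in> bcontfun" if "continuous_on {0..T} z" for z
  proof -
    have "continuous_on {0..T} (I z)"
      by (rule continuous_on_vector_derivative, rule dI[OF that])
    then have *: "continuous_on {0..T} (\<lambda>t. exp (- K * t) *\<^sub>R I z t)"
      by (intro continuous_intros)
    then have "bounded ((\<lambda>t. exp (- K * t) *\<^sub>R I z t) ` {0..T})"
      by (intro compact_imp_bounded compact_continuous_image) auto
    then have "bounded (range (P z))"
      by (rule bounded_subset) (use c in \<open>auto simp: P_def\<close>)
    moreover have "continuous_on UNIV (P z)"
      unfolding P_def using c
      by (intro continuous_on_compose2[OF * cont_c]) auto
    ultimately show ?thesis by (simp add: bcontfun_def)
  qed
  define \<Psi> where "\<Psi> z = Bcontfun (P (apply_bcontfun z))" for z :: "real \<Rightarrow>\<^sub>C 'a"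
  have \<Psi>: "apply_bcontfun (\<Psi> z) = P (apply_bcontfun z)" for z
    unfolding \<Psi>_def by (rule Bcontfun_inverse) (rule P, simp)
  have "\<exists>!z. \<Psi> z = z"
  proof (rule banach_fix_type)
    show "0 \<le> L / K" "L / K < 1" using L by (auto simp: K_def)
    show "\<forall>z w. dist (\<Psi> z) (\<Psi> w) \<le> L / K * dist z w"
    proof (intro allI dist_bound)
      fix z w :: "real \<Rightarrow>\<^sub>C 'a" and t
      let ?t = "c t"
      have sub: "{0..?t} \<subseteq> {0..T}" using c(1)[of t] by auto
      have int: "(\<lambda>s. F s (exp (K * s) *\<^sub>R apply_bcontfun z s)) integrable_on {0..?t}" for z
        by (intro integrable_continuous_real continuous_on_subset[OF contF sub]) simp
      have ex: "((\<lambda>s. L * exp (K * s) * dist z w) has_integral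
          (L * exp (K * ?t) * dist z w / K - L * exp (K * 0) * dist z w / K)) {0..?t}"
        using c(1)[of t] \<open>0 < K\<close>
        by (intro fundamental_theorem_of_calculus)
          (auto intro!: derivative_eq_intros simp: has_real_derivative_iff_has_vector_derivative[symmetric])
      have "norm (I z ?t - I w ?t) =
          norm (integral {0..?t} (\<lambda>s. F s (exp (K * s) *\<^sub>R z s) - F s (exp (K * s) *\<^sub>R w s)))"
        by (simp add: I_def integral_diff int)
      also have "\<dots> \<le> integral {0..?t} (\<lambda>s. L * exp (K * s) * dist z w)"
      proof (rule integral_norm_bound_integral)
        fix s assume s: "s \<in> {0..?t}"
        have "norm (F s (exp (K * s) *\<^sub>R z s) - F s (exp (K * s) *\<^sub>R w s))
            \<le> L * norm (exp (K * s) *\<^sub>R z s - exp (K * s) *\<^sub>R w s)"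
          using s sub by (intro lip) auto
        also have "\<dots> = L * exp (K * s) * dist (z s) (w s)"
          by (simp add: dist_norm flip: scaleR_diff_right)
        also have "\<dots> \<le> L * exp (K * s) * dist z w"
          using L by (intro mult_left_mono dist_bounded) auto
        finally show "norm (F s (exp (K * s) *\<^sub>R z s) - F s (exp (K * s) *\<^sub>R w s)) \<le> \<dots>" .
      qed (use int ex in \<open>auto intro!: integrable_diff\<close>)
      also have "\<dots> \<le> L / K * exp (K * ?t) * dist z w"
        using integral_unique[OF ex] L \<open>0 < K\<close> by simp
      finally have "exp (- K * ?t) * norm (I z ?t - I w ?t)
          \<le> exp (- K * ?t) * (L / K * exp (K * ?t) * dist z w)"
        by (intro mult_left_mono) auto
      also have "\<dots> = L / K * dist z w"
        by (simp add: exp_minus)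
      finally show "dist (\<Psi> z t) (\<Psi> w t) \<le> L / K * dist z w"
        unfolding \<Psi> P_def by (simp add: dist_norm flip: scaleR_diff_right)
    qed
  qed
  then obtain z where z: "\<Psi> z = z" by blast
  define y where "y t = exp (K * t) *\<^sub>R apply_bcontfun z t" for t
  have y: "y t = I z t" if "t \<in> {0..T}" for t
  proof -
    have "apply_bcontfun z t = exp (- K * t) *\<^sub>R I z t"
      using arg_cong[OF z, of "\<lambda>z. apply_bcontfun z t"] c(2)[OF that] by (simp add: \<Psi> P_def)
    then show ?thesis by (simp add: y_def exp_minus)
  qed
  show ?thesis
  proof
    show "y 0 = y0" using y[of 0] T by (simp add: I_def)
    fix t assume t: "t \<in> {0..T}"
    have "(I z has_vector_derivative F t (y t)) (at t within {0..T})"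
      unfolding y_def by (rule dI) (use t in auto)
    then show "(y has_vector_derivative F t (y t)) (at t within {0..T})"
      using t y by (auto intro: has_vector_derivative_transform[where f = "I z"])
  qed
qed

section \<open>Integration by parts against a bounded measurable function\<close>

lemma continuous_on_interval_norm_bound:
  fixes g :: "real \<Rightarrow> 'a::real_normed_vector"
  assumes "continuous_on {a..b} g"
  obtains B where "0 < B" "\<And>t. t \<in> {a..b} \<Longrightarrow> norm (g t) \<le> B"
proof -
  have "bounded (g ` {a..b})"
    by (intro compact_imp_bounded compact_continuous_image assms) auto
  then obtain B where "0 < B" "\<forall>x\<in>g ` {a..b}. norm x \<le> B"
    unfolding bounded_pos by blast
  then show ?thesis by (auto intro!: that)
qed

lemma bounded_measurable_integrable_on:
  fixes h :: "real \<Rightarrow> 'a::euclidean_space"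
  assumes "h \<in> borel_measurable (lebesgue_on {a..b})" "\<And>t. t \<in> {a..b} \<Longrightarrow> norm (h t) \<le> M"
  shows "h integrable_on {a..b}"
  by (rule measurable_bounded_by_integrable_imp_integrable[where g = "\<lambda>_. M"]) (use assms in auto)

lemma inner_integrable_on:
  fixes g h :: "real \<Rightarrow> 'a::euclidean_space"
  assumes g: "continuous_on {a..b} g"
    and h: "h \<in> borel_measurable (lebesgue_on {a..b})" "\<And>t. t \<in> {a..b} \<Longrightarrow> norm (h t) \<le> M"
  shows "(\<lambda>t. g t \<bullet> h t) integrable_on {a..b}"
proof -
  obtain B where B: "\<And>t. t \<in> {a..b} \<Longrightarrow> norm (g t) \<le> B"
    using continuous_on_interval_norm_bound[OF g] by blast
  show ?thesis
  proof (rule bounded_measurable_integrable_on)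
    show "(\<lambda>t. g t \<bullet> h t) \<in> borel_measurable (lebesgue_on {a..b})"
      by (intro borel_measurable_inner h continuous_imp_measurable_on_sets_lebesgue g) auto
    show "norm (g t \<bullet> h t) \<le> B * M" if "t \<in> {a..b}" for t
      using Cauchy_Schwarz_ineq2[of "g t" "h t"] mult_mono[OF B[OF that] h(2)[OF that]]
        order.trans[OF norm_ge_zero B[OF that]] by simp
  qed
qed

lemma quadratic_bound_imp_zero_deriv:
  fixes Q :: "real \<Rightarrow> real"
  assumes "\<And>s. s \<in> S \<Longrightarrow> \<bar>Q s - Q t\<bar> \<le> C * (s - t)\<^sup>2"
  shows "(Q has_real_derivative 0) (at t within S)"
  unfolding has_field_derivative_iff
proof (rule Lim_null_comparison)
  show "\<forall>\<^sub>F s in at t within S. norm ((Q s - Q t) / (s - t)) \<le> C * \<bar>s - t\<bar>"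
    unfolding eventually_at_filter
  proof (intro always_eventually allI impI)
    fix s assume "s \<noteq> t" "s \<in> S"
    with assms[of s] show "norm ((Q s - Q t) / (s - t)) \<le> C * \<bar>s - t\<bar>"
      by (simp add: divide_le_eq power2_eq_square algebra_simps flip: abs_mult_self_eq[of "s - t"])
  qed
  show "((\<lambda>s. C * \<bar>s - t\<bar>) \<longlongrightarrow> 0) (at t within S)"
    by (auto intro!: tendsto_eq_intros)
qed

text \<open>
  The indefinite integral \<open>V\<close> is differentiable only almost everywhere, so the library's integration
  by parts does not apply; but \<open>g \<bullet> V - \<integral> g \<bullet> v\<close> is differentiable everywhere.
\<close>

lemma integration_by_parts_indefinite:
  fixes g g' v :: "real \<Rightarrow> 'a::euclidean_space"
  assumes T: "0 \<le> T"
    and der: "\<And>t. t \<in> {0..T} \<Longrightarrow> (g has_vector_derivative g' t) (at t within {0..T})"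
    and cont: "continuous_on {0..T} g'"
    and v: "v \<in> borel_measurable (lebesgue_on {0..T})" "\<And>t. t \<in> {0..T} \<Longrightarrow> norm (v t) \<le> M"
  shows "((\<lambda>t. g' t \<bullet> integral {0..t} v) has_integral
           g T \<bullet> integral {0..T} v - integral {0..T} (\<lambda>t. g t \<bullet> v t)) {0..T}"
proof -
  define V where "V t = integral {0..t} v" for t
  define J where "J t = integral {0..t} (\<lambda>s. g s \<bullet> v s)" for t
  have gc: "continuous_on {0..T} g"
    by (rule continuous_on_vector_derivative, rule der)
  have vi: "v integrable_on {0..T}"
    by (rule bounded_measurable_integrable_on[OF v])
  have gvi: "(\<lambda>s. g s \<bullet> v s) integrable_on {0..T}"
    by (rule inner_integrable_on[OF gc v])
  obtain B where B: "\<And>t. t \<in> {0..T} \<Longrightarrow> norm (g' t) \<le> B"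
    using continuous_on_interval_norm_bound[OF cont] by blast
  have lip: "norm (g s - g r) \<le> B * \<bar>s - r\<bar>" if "s \<in> {0..T}" "r \<in> {0..T}" for s r
  proof -
    have "norm (g s - g r) \<le> B * norm (s - r)"
    proof (rule differentiable_bound[where S = "{0..T}"])
      show "onorm (\<lambda>h. h *\<^sub>R g' x) \<le> B" if "x \<in> {0..T}" for x
        using mult_right_mono[OF B[OF that] abs_ge_zero] by (intro onorm_le) (simp add: mult.commute)
    qed (use that der in \<open>auto simp: has_vector_derivative_def\<close>)
    then show ?thesis by simp
  qed
  have M: "0 \<le> M" and B0: "0 \<le> B"
    using v(2)[of 0] B[of 0] T by (auto intro: order.trans[OF norm_ge_zero])
  \<comment> \<open>The left side is the integral of \<open>(g c - g s) \<bullet> v s\<close> over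
    \<open>{a..b}\<close>, and both the first factor and the length are of order
    \<open>b - a\<close>. Leaving \<open>c\<close> free lets one estimate serve points on either
    side of \<open>t\<close>.\<close>
  have key: "\<bar>g c \<bullet> (V b - V a) - (J b - J a)\<bar> \<le> B * M * (b - a)\<^sup>2"
    if "a \<in> {0..T}" "b \<in> {0..T}" "a \<le> b" "c \<in> {a..b}" for a b c
  proof -
    have sub: "{a..b} \<subseteq> {0..T}" using that by auto
    have int: "v integrable_on {0..b}" "(\<lambda>s. g s \<bullet> v s) integrable_on {0..b}"
      "v integrable_on {a..b}" "(\<lambda>s. g s \<bullet> v s) integrable_on {a..b}"
      using that by (auto intro: integrable_on_subinterval[OF vi] integrable_on_subinterval[OF gvi])
    have "V b - V a = integral {a..b} v" "J b - J a = integral {a..b} (\<lambda>s. g s \<bullet> v s)"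
      unfolding V_def J_def using that Henstock_Kurzweil_Integration.integral_combine[OF _ _ int(1), of a]
        Henstock_Kurzweil_Integration.integral_combine[OF _ _ int(2), of a]
      by (auto simp: algebra_simps)
    then have "((\<lambda>s. g c \<bullet> v s - g s \<bullet> v s) has_integral g c \<bullet> (V b - V a) - (J b - J a)) (cbox a b)"
      using int has_integral_linear[OF integrable_integral[OF int(3)] bounded_linear_inner_right[of "g c"]]
      by (auto intro!: has_integral_diff integrable_integral simp: o_def)
    then have "norm (g c \<bullet> (V b - V a) - (J b - J a)) \<le> (B * (b - a) * M) * measure lborel (cbox a b)"
    proof (rule has_integral_bound[rotated])
      fix s assume "s \<in> cbox a b"
      then have s: "s \<in> {a..b}" by simp
      have "norm ((g c - g s) \<bullet> v s) \<le> norm (g c - g s) * norm (v s)"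
        by (simp add: Cauchy_Schwarz_ineq2)
      also have "\<dots> \<le> (B * (b - a)) * M"
      proof (rule mult_mono)
        have "norm (g c - g s) \<le> B * \<bar>c - s\<bar>" using s sub that by (intro lip) auto
        also have "\<dots> \<le> B * (b - a)" using s that B0 by (intro mult_left_mono) auto
        finally show "norm (g c - g s) \<le> B * (b - a)" .
      qed (use s sub v(2) that B0 M in auto)
      finally show "norm (g c \<bullet> v s - g s \<bullet> v s) \<le> B * (b - a) * M"
        by (simp add: inner_diff_left)
    qed (use that B0 M in auto)
    then show ?thesis using that by (simp add: power2_eq_square mult_ac)
  qed
  have "((\<lambda>s. g s \<bullet> V s - J s) has_vector_derivative g' t \<bullet> V t) (at t within {0..T})"
    if t: "t \<in> {0..T}" for t
  proof -
    \<comment> \<open>\<open>Q\<close> carries all of the nonsmooth dependence on \<open>V\<close>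
      and \<open>J\<close>: the function to be differentiated is
      \<open>Q s + (g s \<bullet> V t - J t)\<close>, where \<open>V t\<close> and
      \<open>J t\<close> are constants.\<close>
    define Q where "Q s = g s \<bullet> (V s - V t) - (J s - J t)" for s
    have "(Q has_real_derivative 0) (at t within {0..T})"
    proof (rule quadratic_bound_imp_zero_deriv)
      fix s assume "s \<in> {0..T}"
      then show "\<bar>Q s - Q t\<bar> \<le> B * M * (s - t)\<^sup>2"
        using key[of t s s] key[of s t s] t
        by (cases "t \<le> s") (auto simp: Q_def algebra_simps power2_commute[of s t] abs_minus_commute)
    qed
    moreover have "((\<lambda>s. g s \<bullet> V t - J t) has_real_derivative g' t \<bullet> V t) (at t within {0..T})"
      using der[OF t]
      by (auto intro!: derivative_eq_intros simp: has_real_derivative_iff_has_vector_derivative has_vector_derivative_def)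
    ultimately have "((\<lambda>s. Q s + (g s \<bullet> V t - J t)) has_real_derivative 0 + g' t \<bullet> V t) (at t within {0..T})"
      by (rule DERIV_add)
    then show ?thesis
      by (simp add: Q_def inner_diff_right has_real_derivative_iff_has_vector_derivative)
  qed
  from fundamental_theorem_of_calculus[OF T this]
  show ?thesis by (simp add: V_def J_def)
qed

lemma norm_linear_le_sum_Basis:
  fixes A :: "'a::euclidean_space \<Rightarrow> 'b::real_normed_vector"
  assumes "linear A"
  shows "norm (A v) \<le> (\<Sum>e\<in>Basis. norm (A e)) * norm v"
proof -
  have "A v = (\<Sum>e\<in>Basis. (v \<bullet> e) *\<^sub>R A e)"
    by (subst euclidean_representation[of v, symmetric])
      (simp add: linear_sum[OF assms] linear_cmul[OF assms] del: euclidean_representation)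
  also have "norm \<dots> \<le> (\<Sum>e\<in>Basis. norm v * norm (A e))"
    by (intro sum_norm_le) (auto intro!: mult_right_mono Basis_le_norm)
  finally show ?thesis by (simp add: sum_distrib_left mult.commute)
qed

section \<open>Trajectories of a field with an additive control\<close>

text \<open>The control fields of the chain are constant, so the whole control term is a function
  \<open>w\<close> of time with values in the state space.\<close>

definition controlled_solution ::
  "('a::euclidean_space \<Rightarrow> 'a) \<Rightarrow> real \<Rightarrow> (real \<Rightarrow> 'a) \<Rightarrow> (real \<Rightarrow> 'a) \<Rightarrow> bool" where
  "controlled_solution F T w X \<longleftrightarrow>
     (\<forall>t\<in>{0..T}. ((\<lambda>s. F (X s) + w s) has_integral (X t - X 0)) {0..t})"

lemma controlled_solution_continuous:
  assumes "controlled_solution F T w X" "0 \<le> T"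
  shows "continuous_on {0..T} X"
proof -
  have int: "((\<lambda>s. F (X s) + w s) has_integral (X t - X 0)) {0..t}" if "t \<in> {0..T}" for t
    using assms that by (auto simp: controlled_solution_def)
  have "continuous_on {0..T} (\<lambda>t. X 0 + integral {0..t} (\<lambda>s. F (X s) + w s))"
    using int[of T] \<open>0 \<le> T\<close>
    by (intro continuous_intros indefinite_integral_continuous_1) (auto simp: integrable_on_def)
  then show ?thesis
    by (rule continuous_on_eq) (simp add: integral_unique[OF int])
qed

lemma controlled_solution_subinterval:
  assumes "controlled_solution F T w X" "T' \<le> T"
  shows "controlled_solution F T' w X"
  using assms by (auto simp: controlled_solution_def)

text \<open>Used to pass between a field and its clamped version along a trajectory that stays where
  they agree.\<close>

lemma controlled_solution_cong:
  assumes "controlled_solution F T w X" "\<And>t. t \<in> {0..T} \<Longrightarrow> F (X t) = G (X t)"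
  shows "controlled_solution G T w X"
  unfolding controlled_solution_def
proof
  fix t assume t: "t \<in> {0..T}"
  then have "((\<lambda>s. F (X s) + w s) has_integral (X t - X 0)) {0..t}"
    using assms(1) by (simp add: controlled_solution_def)
  then show "((\<lambda>s. G (X s) + w s) has_integral (X t - X 0)) {0..t}"
    by (rule has_integral_eq[rotated]) (use t assms(2) in auto)
qed

lemma lipschitz_imp_continuous_on:
  fixes F :: "'a::real_normed_vector \<Rightarrow> 'b::real_normed_vector"
  assumes "0 \<le> L" "\<And>y z. norm (F y - F z) \<le> L * norm (y - z)"
  shows "continuous_on S F"
  by (rule lipschitz_on_continuous_on[of L], rule lipschitz_onI) (use assms in \<open>auto simp: dist_norm\<close>)

text \<open>Subtracting the indefinite integral \<open>W\<close> of the control leaves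
  \<open>y' = F (y + W t)\<close>, whose right side is continuous. The classical existence theorem
  thus covers merely integrable controls.\<close>

lemma controlled_solution_exists:
  fixes F :: "'a::euclidean_space \<Rightarrow> 'a"
  assumes T: "0 \<le> T" and L: "0 \<le> L" and lip: "\<And>y z. norm (F y - F z) \<le> L * norm (y - z)"
    and w: "w integrable_on {0..T}"
  obtains X where "X 0 = x0" "controlled_solution F T w X"
proof -
  define W where "W t = integral {0..t} w" for t
  have W: "continuous_on {0..T} W"
    unfolding W_def by (rule indefinite_integral_continuous_1[OF w])
  have F: "continuous_on S F" for S by (rule lipschitz_imp_continuous_on[OF L lip])
  have cont: "continuous_on ({0..T} \<times> UNIV) (\<lambda>(t, y). F (y + W t))"
    unfolding split_beta
    by (intro continuous_on_compose2[OF F] continuous_intros continuous_on_compose2[OF W]) auto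
  obtain y where y: "y 0 = x0"
    and dy: "\<And>t. t \<in> {0..T} \<Longrightarrow> (y has_vector_derivative F (y t + W t)) (at t within {0..T})"
  proof (rule picard_lindelof_global[OF T L cont])
    show "norm (F (y + W t) - F (z + W t)) \<le> L * norm (y - z)" for t y z
      using lip[of "y + W t" "z + W t"] by simp
  qed blast
  show ?thesis
  proof
    show "y 0 + W 0 = x0" by (simp add: y W_def)
    show "controlled_solution F T w (\<lambda>t. y t + W t)"
      unfolding controlled_solution_def
    proof
      fix t assume t: "t \<in> {0..T}"
      have "((\<lambda>s. F (y s + W s)) has_integral (y t - y 0)) {0..t}"
        by (rule fundamental_theorem_of_calculus)
          (use t dy in \<open>auto intro: has_vector_derivative_within_subset[OF dy]\<close>)
      moreover have "(w has_integral W t) {0..t}"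
        unfolding W_def using t
        by (intro integrable_integral integrable_on_subinterval[OF w]) auto
      ultimately show "((\<lambda>s. F (y s + W s) + w s) has_integral (y t + W t - (y 0 + W 0))) {0..t}"
        by (auto dest: has_integral_add simp: W_def algebra_simps)
    qed
  qed
qed

lemma controlled_solution_diff:
  fixes F :: "'a::euclidean_space \<Rightarrow> 'a"
  assumes F: "continuous_on UNIV F"
    and X: "controlled_solution F T w X" and Y: "controlled_solution F T h Y" and "X 0 = Y 0"
    and w: "w integrable_on {0..T}" and h: "h integrable_on {0..T}" and t: "t \<in> {0..T}"
  shows "X t - Y t = integral {0..t} (\<lambda>s. F (X s) - F (Y s)) + integral {0..t} (\<lambda>s. w s - h s)"
proof -
  have cont: "continuous_on {0..T} X" "continuous_on {0..T} Y"
    using X Y t by (auto intro: controlled_solution_continuous)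
  have FI: "(\<lambda>s. F (Z s)) integrable_on {0..t}" if "continuous_on {0..T} Z" for Z
    using t by (intro integrable_continuous_real continuous_on_compose2[OF F]
        continuous_on_subset[OF that]) auto
  have I: "w integrable_on {0..t}" "h integrable_on {0..t}"
    using t by (auto intro: integrable_on_subinterval[OF w] integrable_on_subinterval[OF h])
  have "X t - X 0 = integral {0..t} (\<lambda>s. F (X s) + w s)" "Y t - Y 0 = integral {0..t} (\<lambda>s. F (Y s) + h s)"
    using X Y t by (auto simp: controlled_solution_def intro!: integral_unique[symmetric])
  then show ?thesis
    using \<open>X 0 = Y 0\<close> FI[OF cont(1)] FI[OF cont(2)] I
    by (simp add: integral_add integral_diff algebra_simps)
qed

text \<open>Gronwall applied to the distance of the trajectories; the controls enter only through
  the integral of their difference.\<close>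

lemma controlled_solution_stable:
  fixes F :: "'a::euclidean_space \<Rightarrow> 'a"
  assumes L: "0 \<le> L" and lip: "\<And>y z. norm (F y - F z) \<le> L * norm (y - z)"
    and X: "controlled_solution F T w X" and Y: "controlled_solution F T h Y" and "X 0 = Y 0"
    and w: "w integrable_on {0..T}" and h: "h integrable_on {0..T}"
    and d: "\<And>t. t \<in> {0..T} \<Longrightarrow> norm (integral {0..t} (\<lambda>s. w s - h s)) \<le> d"
    and t: "t \<in> {0..T}"
  shows "norm (X t - Y t) \<le> d * exp (L * T)"
proof -
  have F: "continuous_on S F" for S by (rule lipschitz_imp_continuous_on[OF L lip])
  have cont: "continuous_on {0..T} X" "continuous_on {0..T} Y"
    using X Y t by (auto intro: controlled_solution_continuous)
  have "0 \<le> d" using d[OF t] by (rule order.trans[OF norm_ge_zero])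
  have "norm (X t - Y t) \<le> d * exp (L * t)"
  proof (rule gronwall[OF _ L _ t])
    show nc: "continuous_on {0..T} (\<lambda>t. norm (X t - Y t))"
      by (intro continuous_intros cont)
    fix t assume t: "t \<in> {0..T}"
    then have sub: "{0..t} \<subseteq> {0..T}" by auto
    have "norm (integral {0..t} (\<lambda>s. F (X s) - F (Y s))) \<le> integral {0..t} (\<lambda>s. L * norm (X s - Y s))"
      by (intro integral_norm_bound_integral integrable_continuous_real continuous_intros lip
          continuous_on_compose2[OF F[of UNIV]] continuous_on_subset[OF cont(1) sub]
          continuous_on_subset[OF cont(2) sub]) auto
    then show "norm (X t - Y t) \<le> d + L * integral {0..t} (\<lambda>s. norm (X s - Y s))"
      using controlled_solution_diff[OF F X Y \<open>X 0 = Y 0\<close> w h t] d[OF t]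
        norm_triangle_ineq[of "integral {0..t} (\<lambda>s. F (X s) - F (Y s))" "integral {0..t} (\<lambda>s. w s - h s)"]
      by simp
  qed
  also have "\<dots> \<le> d * exp (L * T)"
    using t L \<open>0 \<le> d\<close> by (intro mult_left_mono) (auto intro: mult_left_mono)
  finally show ?thesis .
qed

lemma controlled_solution_time_lipschitz:
  assumes X: "controlled_solution F T w X"
    and bound: "\<And>t. t \<in> {0..T} \<Longrightarrow> norm (F (X t) + w t) \<le> B"
    and st: "0 \<le> s" "s \<le> t" "t \<le> T"
  shows "norm (X t - X s) \<le> B * (t - s)"
proof -
  have I: "((\<lambda>s. F (X s) + w s) has_integral (X r - X 0)) {0..r}" if "r \<in> {0..T}" for r
    using X that by (simp add: controlled_solution_def)
  have "(\<lambda>s. F (X s) + w s) integrable_on {s..t}"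
    by (rule integrable_on_subinterval[of _ "{0..T}"]) (use I[of T] st in \<open>auto simp: integrable_on_def\<close>)
  moreover have "integral {s..t} (\<lambda>s. F (X s) + w s) = X t - X s"
  proof -
    have "integral {0..s} (\<lambda>s. F (X s) + w s) + integral {s..t} (\<lambda>s. F (X s) + w s)
        = integral {0..t} (\<lambda>s. F (X s) + w s)"
      using st I[of t] by (intro Henstock_Kurzweil_Integration.integral_combine)
        (auto simp: integrable_on_def)
    then show ?thesis
      using I[of s] I[of t] st by (simp add: integral_unique algebra_simps)
  qed
  ultimately have "((\<lambda>s. F (X s) + w s) has_integral (X t - X s)) (cbox s t)"
    by (metis box_real(2) integrable_integral)
  then have "norm (X t - X s) \<le> B * measure lborel (cbox s t)"
    by (rule has_integral_bound[rotated])
      (use bound st in \<open>auto intro: order.trans[OF norm_ge_zero bound[of 0]]\<close>)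
  then show ?thesis using st by simp
qed

lemma adjoint_eq_sum_Basis:
  fixes A :: "'a::euclidean_space \<Rightarrow> 'b::euclidean_space"
  assumes "linear A"
  shows "adjoint A m = (\<Sum>e\<in>Basis. (m \<bullet> A e) *\<^sub>R e)"
proof -
  have "adjoint A m \<bullet> e = m \<bullet> A e" for e
    using adjoint_works[OF assms, of e m] by (simp add: inner_commute)
  then show ?thesis
    using euclidean_representation[of "adjoint A m"] by simp
qed

lemma continuous_on_adjoint:
  fixes A :: "'c::topological_space \<Rightarrow> 'a::euclidean_space \<Rightarrow> 'b::euclidean_space"
  assumes lin: "\<And>t. t \<in> S \<Longrightarrow> linear (A t)"
    and A: "\<And>v. continuous_on S (\<lambda>t. A t v)" and \<mu>: "continuous_on S \<mu>"
  shows "continuous_on S (\<lambda>t. adjoint (A t) (\<mu> t))"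
proof -
  have "continuous_on S (\<lambda>t. (\<Sum>e\<in>Basis. (\<mu> t \<bullet> A t e) *\<^sub>R e))"
    by (intro continuous_intros A \<mu>)
  then show ?thesis
    by (rule continuous_on_eq) (simp add: adjoint_eq_sum_Basis lin)
qed

section \<open>The adjoint equation\<close>

locale linear_ode =
  fixes A :: "real \<Rightarrow> 'a::euclidean_space \<Rightarrow> 'a" and T L :: real
  assumes T: "0 \<le> T"
    and lin: "\<And>t. t \<in> {0..T} \<Longrightarrow> linear (A t)"
    and cont: "\<And>v. continuous_on {0..T} (\<lambda>t. A t v)"
    and L: "0 \<le> L" and bound: "\<And>t v. t \<in> {0..T} \<Longrightarrow> norm (A t v) \<le> L * norm v"
begin

definition adjoint_solution :: "(real \<Rightarrow> 'a) \<Rightarrow> bool" where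
  "adjoint_solution \<mu> \<longleftrightarrow>
     (\<forall>t\<in>{0..T}. (\<mu> has_vector_derivative - adjoint (A t) (\<mu> t)) (at t within {0..T}))"

lemma adjoint_bound:
  assumes "t \<in> {0..T}"
  shows "norm (adjoint (A t) m) \<le> L * norm m"
proof (cases "adjoint (A t) m = 0")
  case False
  have "norm (adjoint (A t) m) ^ 2 = m \<bullet> A t (adjoint (A t) m)"
    by (simp add: power2_norm_eq_inner adjoint_works[OF lin[OF assms]] inner_commute)
  also have "\<dots> \<le> norm m * (L * norm (adjoint (A t) m))"
    by (rule order.trans[OF norm_cauchy_schwarz]) (intro mult_left_mono bound assms norm_ge_zero)
  finally have "norm (adjoint (A t) m) * norm (adjoint (A t) m) \<le> (L * norm m) * norm (adjoint (A t) m)"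
    by (simp add: power2_eq_square mult_ac)
  then show ?thesis
    by (rule mult_right_le_imp_le) (use False in simp)
qed (use L in simp)

text \<open>The value is prescribed at the final time, so the existence theorem is applied in the
  reversed time \<open>T - t\<close>.\<close>

lemma adjoint_solution_exists:
  obtains \<mu> where "\<mu> T = c" "adjoint_solution \<mu>"
proof -
  have rev: "T - t \<in> {0..T}" if "t \<in> {0..T}" for t using that by auto
  have cont2: "continuous_on ({0..T} \<times> UNIV) (\<lambda>(t, y). adjoint (A (T - t)) y)"
    unfolding split_beta
  proof (rule continuous_on_adjoint[where A = "\<lambda>p. A (T - fst p)" and \<mu> = snd])
    show "continuous_on ({0..T} \<times> UNIV) (\<lambda>p. A (T - fst p) v)" for v
      by (intro continuous_on_compose2[OF cont[of v]] continuous_intros) auto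
  qed (use rev lin in \<open>auto intro!: continuous_intros\<close>)
  obtain y where y: "y 0 = c"
    and dy: "\<And>t. t \<in> {0..T} \<Longrightarrow> (y has_vector_derivative adjoint (A (T - t)) (y t)) (at t within {0..T})"
  proof (rule picard_lindelof_global[OF T L cont2])
    fix t y z assume t: "t \<in> {0..T}"
    show "norm (adjoint (A (T - t)) y - adjoint (A (T - t)) z) \<le> L * norm (y - z)"
      using adjoint_bound[OF rev[OF t], of "y - z"] adjoint_linear[OF lin[OF rev[OF t]]]
      by (simp add: linear_diff)
  qed blast
  show ?thesis
  proof (rule that[of "\<lambda>t. y (T - t)"])
    show "y (T - T) = c" by (simp add: y)
    show "adjoint_solution (\<lambda>t. y (T - t))"
      unfolding adjoint_solution_def
    proof
      fix t assume t: "t \<in> {0..T}"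
      have "(y has_vector_derivative adjoint (A t) (y (T - t))) (at (T - t) within (\<lambda>t. T - t) ` {0..T})"
        using has_vector_derivative_within_subset[OF dy[OF rev[OF t]], of "(\<lambda>t. T - t) ` {0..T}"] by auto
      moreover have "((\<lambda>t. T - t) has_vector_derivative - 1) (at t within {0..T})"
        by (auto intro!: derivative_eq_intros simp: has_real_derivative_iff_has_vector_derivative[symmetric])
      ultimately have "(y \<circ> (\<lambda>t. T - t) has_vector_derivative - 1 *\<^sub>R adjoint (A t) (y (T - t))) (at t within {0..T})"
        by (intro vector_diff_chain_within)
      then show "((\<lambda>t. y (T - t)) has_vector_derivative - adjoint (A t) (y (T - t))) (at t within {0..T})"
        by (simp add: o_def)
    qed
  qed
qed

lemma adjoint_solution_continuous: "adjoint_solution \<mu> \<Longrightarrow> continuous_on {0..T} \<mu>"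
  unfolding adjoint_solution_def
  by (rule continuous_on_vector_derivative) auto

text \<open>The weighted square \<open>exp (- 2 * L * s) * (\<mu> s \<bullet> \<mu> s)\<close>
  cannot increase, so a zero at \<open>t\<close> would persist up to \<open>T\<close>.\<close>

lemma adjoint_solution_nonzero:
  assumes \<mu>: "adjoint_solution \<mu>" and "\<mu> T \<noteq> 0" and t: "t \<in> {0..T}"
  shows "\<mu> t \<noteq> 0"
proof
  assume "\<mu> t = 0"
  define g where "g s = exp (- 2 * L * s) * (\<mu> s \<bullet> \<mu> s)" for s
  have "g T \<le> g t"
  proof (rule nonpos_deriv_within_imp_le[where g = g and g' = "\<lambda>s. exp (- 2 * L * s) *
        (- 2 * L * (\<mu> s \<bullet> \<mu> s) - 2 * (\<mu> s \<bullet> adjoint (A s) (\<mu> s)))"])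
    fix s assume "s \<in> {t..T}"
    then have s: "s \<in> {0..T}" using t by auto
    have "(\<mu> has_vector_derivative - adjoint (A s) (\<mu> s)) (at s within {t..T})"
      by (rule has_vector_derivative_within_subset[of _ _ _ "{0..T}"])
        (use \<mu> s t in \<open>auto simp: adjoint_solution_def\<close>)
    from bounded_bilinear.has_vector_derivative[OF bounded_bilinear_inner this this]
    have "((\<lambda>s. \<mu> s \<bullet> \<mu> s) has_real_derivative - 2 * (\<mu> s \<bullet> adjoint (A s) (\<mu> s))) (at s within {t..T})"
      by (simp add: has_real_derivative_iff_has_vector_derivative inner_commute)
    then show "(g has_real_derivative
        exp (- 2 * L * s) * (- 2 * L * (\<mu> s \<bullet> \<mu> s) - 2 * (\<mu> s \<bullet> adjoint (A s) (\<mu> s)))) (at s within {t..T})"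
      unfolding g_def by (auto intro!: derivative_eq_intros simp: algebra_simps)
    have "\<bar>\<mu> s \<bullet> adjoint (A s) (\<mu> s)\<bar> \<le> norm (\<mu> s) * (L * norm (\<mu> s))"
      by (rule order.trans[OF Cauchy_Schwarz_ineq2]) (intro mult_left_mono adjoint_bound s norm_ge_zero)
    also have "\<dots> = L * (\<mu> s \<bullet> \<mu> s)"
      by (simp add: power2_norm_eq_inner[symmetric] power2_eq_square)
    finally show "exp (- 2 * L * s) * (- 2 * L * (\<mu> s \<bullet> \<mu> s) - 2 * (\<mu> s \<bullet> adjoint (A s) (\<mu> s))) \<le> 0"
      by (intro mult_nonneg_nonpos) auto
  qed (use t in auto)
  then have "\<mu> T \<bullet> \<mu> T \<le> 0"
    by (simp add: g_def \<open>\<mu> t = 0\<close> mult_le_0_iff)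
  with \<open>\<mu> T \<noteq> 0\<close> show False
    by (metis inner_gt_zero_iff not_less)
qed

text \<open>Differentiating the pairing of \<mu> with \<open>X t - Y t\<close> makes the adjoint
  equation produce the term with \<open>A t\<close>, which leaves only the deviation of
  \<open>F\<close> from the linear map \<open>A t\<close> under the integral. The difference is
  split as \<open>Z + V\<close>: the field part \<open>Z\<close> is continuously differentiable and
  obeys the product rule, the control part \<open>V\<close> requires
  \<open>integration_by_parts_indefinite\<close>.\<close>

lemma adjoint_duality:
  assumes \<mu>: "adjoint_solution \<mu>" and F: "continuous_on UNIV F"
    and X: "controlled_solution F T w X" and Y: "controlled_solution F T h Y" and "X 0 = Y 0"
    and w: "w \<in> borel_measurable (lebesgue_on {0..T})" "\<And>t. t \<in> {0..T} \<Longrightarrow> norm (w t) \<le> M"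
    and h: "h \<in> borel_measurable (lebesgue_on {0..T})" "\<And>t. t \<in> {0..T} \<Longrightarrow> norm (h t) \<le> M"
  shows "((\<lambda>t. \<mu> t \<bullet> (F (X t) - F (Y t) - A t (X t - Y t))) has_integral
          \<mu> T \<bullet> (X T - Y T) - integral {0..T} (\<lambda>t. \<mu> t \<bullet> (w t - h t))) {0..T}"
proof -
  define V where "V t = integral {0..t} (\<lambda>s. w s - h s)" for t
  define Z where "Z t = integral {0..t} (\<lambda>s. F (X s) - F (Y s))" for t
  have wh: "w integrable_on {0..T}" "h integrable_on {0..T}"
    using bounded_measurable_integrable_on w h by blast+
  have eq: "X t - Y t = Z t + V t" if "t \<in> {0..T}" for t
    unfolding Z_def V_def by (rule controlled_solution_diff[OF F X Y \<open>X 0 = Y 0\<close> wh that])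
  have cXY: "continuous_on {0..T} X" "continuous_on {0..T} Y"
    using X Y T by (auto intro: controlled_solution_continuous)
  have d\<mu>: "(\<mu> has_vector_derivative - adjoint (A t) (\<mu> t)) (at t within {0..T})" if "t \<in> {0..T}" for t
    using \<mu> that by (simp add: adjoint_solution_def)
  have "((\<lambda>t. - adjoint (A t) (\<mu> t) \<bullet> integral {0..t} (\<lambda>s. w s - h s)) has_integral
      \<mu> T \<bullet> integral {0..T} (\<lambda>s. w s - h s) - integral {0..T} (\<lambda>t. \<mu> t \<bullet> (w t - h t))) {0..T}"
  proof (rule integration_by_parts_indefinite[OF T d\<mu>])
    show "continuous_on {0..T} (\<lambda>t. - adjoint (A t) (\<mu> t))"
      by (intro continuous_intros continuous_on_adjoint lin cont adjoint_solution_continuous \<mu>)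
    show "(\<lambda>s. w s - h s) \<in> borel_measurable (lebesgue_on {0..T})"
      using w h by (intro borel_measurable_diff)
    show "norm (w t - h t) \<le> M + M" if "t \<in> {0..T}" for t
      using norm_triangle_ineq4[of "w t" "h t"] w(2)[OF that] h(2)[OF that] by linarith
  qed
  moreover have "((\<lambda>t. \<mu> t \<bullet> (F (X t) - F (Y t)) - adjoint (A t) (\<mu> t) \<bullet> Z t) has_integral
      \<mu> T \<bullet> Z T - \<mu> 0 \<bullet> Z 0) {0..T}"
  proof (rule fundamental_theorem_of_calculus[OF T])
    fix t assume t: "t \<in> {0..T}"
    have "(Z has_vector_derivative F (X t) - F (Y t)) (at t within {0..T})"
      unfolding Z_def
      by (intro integral_has_vector_derivative t continuous_intros
          continuous_on_compose2[OF F] cXY) auto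
    from bounded_bilinear.has_vector_derivative[OF bounded_bilinear_inner d\<mu>[OF t] this]
    show "((\<lambda>t. \<mu> t \<bullet> Z t) has_vector_derivative \<mu> t \<bullet> (F (X t) - F (Y t)) - adjoint (A t) (\<mu> t) \<bullet> Z t)
        (at t within {0..T})"
      by simp
  qed
  ultimately have "((\<lambda>t. (\<mu> t \<bullet> (F (X t) - F (Y t)) - adjoint (A t) (\<mu> t) \<bullet> Z t)
        + - adjoint (A t) (\<mu> t) \<bullet> V t) has_integral
      (\<mu> T \<bullet> Z T - \<mu> 0 \<bullet> Z 0) + (\<mu> T \<bullet> V T - integral {0..T} (\<lambda>t. \<mu> t \<bullet> (w t - h t)))) {0..T}"
    unfolding V_def by (intro has_integral_add)
  also have "(\<mu> T \<bullet> Z T - \<mu> 0 \<bullet> Z 0) + (\<mu> T \<bullet> V T - integral {0..T} (\<lambda>t. \<mu> t \<bullet> (w t - h t)))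
      = \<mu> T \<bullet> (X T - Y T) - integral {0..T} (\<lambda>t. \<mu> t \<bullet> (w t - h t))"
    using eq[of T] T by (simp add: Z_def inner_add_right)
  finally show ?thesis
  proof (rule has_integral_eq[rotated])
    fix t assume t: "t \<in> {0..T}"
    have "\<mu> t \<bullet> A t (X t - Y t) = adjoint (A t) (\<mu> t) \<bullet> (Z t + V t)"
      using adjoint_works[OF lin[OF t], of "X t - Y t" "\<mu> t"]
      by (simp only: eq[OF t, symmetric] inner_commute)
    then show "(\<mu> t \<bullet> (F (X t) - F (Y t)) - adjoint (A t) (\<mu> t) \<bullet> Z t) + - adjoint (A t) (\<mu> t) \<bullet> V t
        = \<mu> t \<bullet> (F (X t) - F (Y t) - A t (X t - Y t))"
      by (simp add: inner_diff_right inner_add_right)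
  qed
qed

end

section \<open>The maximum principle\<close>

locale c1_field =
  fixes f :: "'a::euclidean_space \<Rightarrow> 'a" and D :: "'a \<Rightarrow> 'a \<Rightarrow> 'a"
  assumes has_derivative: "\<And>y. (f has_derivative D y) (at y)"
    and continuous_derivative: "\<And>v. continuous_on UNIV (\<lambda>y. D y v)"
begin

lemma linear_derivative: "linear (D y)"
  using has_derivative by (rule has_derivative_linear)

lemma continuous_field: "continuous_on S f"
  using has_derivative by (meson differentiableI differentiable_imp_continuous_on differentiable_at_imp_differentiable_on)

lemma continuous_on_derivative_compose:
  "continuous_on S g \<Longrightarrow> continuous_on S (\<lambda>t. D (g t) v)"
  by (rule continuous_on_compose2[OF continuous_derivative]) auto

text \<open>Continuity of the derivative is available for each fixed vector only. In finite
  dimension the sum of the norms over the basis is a continuous majorant of the operator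
  norm.\<close>

lemma derivative_bound:
  obtains B where "0 < B" "\<And>y v. norm y \<le> R \<Longrightarrow> norm (D y v) \<le> B * norm v"
proof -
  have "continuous_on (cball 0 R) (\<lambda>y. \<Sum>e\<in>Basis. norm (D y e))"
    by (intro continuous_intros continuous_on_derivative_compose)
  then have "bounded ((\<lambda>y. \<Sum>e\<in>Basis. norm (D y e)) ` cball 0 R)"
    by (intro compact_imp_bounded compact_continuous_image) auto
  then obtain B where B: "0 < B" "\<And>y. y \<in> cball 0 R \<Longrightarrow> norm (\<Sum>e\<in>Basis. norm (D y e)) \<le> B"
    unfolding bounded_pos by blast
  have "norm (D y v) \<le> B * norm v" if "norm y \<le> R" for y v
  proof -
    have "(\<Sum>e\<in>Basis. norm (D y e)) \<le> B" using B(2)[of y] that by simp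
    then show ?thesis
      using norm_linear_le_sum_Basis[OF linear_derivative, of y v]
      by (meson mult_right_mono norm_ge_zero order.trans)
  qed
  with B(1) show ?thesis by (rule that)
qed

text \<open>\<open>F\<close> is the field composed with the nearest-point projection onto the ball.
  The projection does not increase distances, so a Lipschitz constant on the ball becomes a global
  one.\<close>

lemma clamped_field:
  assumes "0 \<le> R"
  obtains F L B where "0 < L" "\<And>y z. norm (F y - F z) \<le> L * norm (y - z)"
    "\<And>y. norm (F y) \<le> B" "\<And>y. norm y \<le> R \<Longrightarrow> F y = f y"
proof -
  define p where "p = closest_point (cball (0 :: 'a) R)"
  have ball: "convex (cball (0 :: 'a) R)" "closed (cball (0 :: 'a) R)" "cball (0 :: 'a) R \<noteq> {}"
    using assms by auto
  have p: "p y \<in> cball 0 R" for y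
    unfolding p_def by (rule closest_point_in_set[OF ball(2,3)])
  obtain L where L: "0 < L" "\<And>y v. norm y \<le> R \<Longrightarrow> norm (D y v) \<le> L * norm v"
    by (rule derivative_bound[of R], rule that)
  have lip: "norm (f (p y) - f (p z)) \<le> L * norm (y - z)" for y z
  proof -
    have "norm (f (p y) - f (p z)) \<le> L * norm (p y - p z)"
      by (rule differentiable_bound[OF ball(1), where f' = D])
        (use L p has_derivative in \<open>auto intro: onorm_le has_derivative_at_withinI\<close>)
    also have "\<dots> \<le> L * norm (y - z)"
      using closest_point_lipschitz[OF ball, of y z] L(1) by (simp add: p_def dist_norm)
    finally show ?thesis .
  qed
  have "bounded (f ` cball 0 R)"
    by (intro compact_imp_bounded compact_continuous_image continuous_field) auto
  then obtain B where "\<And>y. y \<in> cball 0 R \<Longrightarrow> norm (f y) \<le> B"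
    unfolding bounded_iff by blast
  then have B: "norm (f (p y)) \<le> B" for y using p by blast
  have "p y = y" if "norm y \<le> R" for y
    unfolding p_def using that by (intro closest_point_self) auto
  then show ?thesis
    by (intro that[of L "\<lambda>y. f (p y)" B] L(1) lip B) auto
qed

lemma uniform_linearization:
  assumes "0 < \<epsilon>"
  obtains \<delta> where "0 < \<delta>"
    "\<And>y z. norm y \<le> R \<Longrightarrow> norm z \<le> \<delta> \<Longrightarrow> norm (f (y + z) - f y - D y z) \<le> \<epsilon> * norm z"
proof -
  \<comment> \<open>\<open>G\<close> vanishes on the diagonal, so its uniform continuity on a
    compact set bounds the oscillation of \<open>D\<close> uniformly in the base point. The radius
    \<open>R + 1\<close> leaves room for increments of size \<delta> \<le> 1.\<close>
  define G where "G = (\<lambda>(y', y). \<Sum>e\<in>Basis. norm (D y' e - D y e))"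
  have "continuous_on (cball 0 (R + 1) \<times> cball 0 (R + 1)) G"
    unfolding G_def split_beta
    by (intro continuous_intros continuous_on_derivative_compose)
  then have "uniformly_continuous_on (cball 0 (R + 1) \<times> cball 0 (R + 1)) G"
    by (intro compact_uniformly_continuous compact_Times) auto
  then obtain d where d: "0 < d"
    "\<And>a b. a \<in> cball 0 (R + 1) \<times> cball 0 (R + 1) \<Longrightarrow> b \<in> cball 0 (R + 1) \<times> cball 0 (R + 1) \<Longrightarrow>
      dist b a < d \<Longrightarrow> dist (G b) (G a) < \<epsilon>"
    using \<open>0 < \<epsilon>\<close> unfolding uniformly_continuous_on_def by metis
  define \<delta> where "\<delta> = min (d / 2) 1"
  have \<delta>: "0 < \<delta>" "\<delta> < d" "\<delta> \<le> 1" using d(1) by (auto simp: \<delta>_def)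
  have "norm (f (y + z) - f y - D y z) \<le> \<epsilon> * norm z" if y: "norm y \<le> R" and z: "norm z \<le> \<delta>" for y z
  proof -
    have "norm ((f (y + z) - D y (y + z)) - (f y - D y y)) \<le> \<epsilon> * norm (y + z - y)"
    proof (rule differentiable_bound[where S = "cball y \<delta>"])
      fix y' assume y': "y' \<in> cball y \<delta>"
      show "((\<lambda>y'. f y' - D y y') has_derivative (\<lambda>v. D y' v - D y v)) (at y' within cball y \<delta>)"
        by (intro derivative_intros has_derivative_at_withinI[OF has_derivative]
            bounded_linear_imp_has_derivative linear_conv_bounded_linear[THEN iffD1] linear_derivative)
      have "norm y' \<le> R + 1"
        using y' y \<delta>(3) norm_triangle_sub[of y' y] by (simp add: dist_norm norm_minus_commute)
      then have "dist (G (y', y)) (G (y, y)) < \<epsilon>"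
        using y' y \<delta> by (intro d(2)) (auto simp: dist_Pair_Pair dist_commute)
      then have "(\<Sum>e\<in>Basis. norm (D y' e - D y e)) \<le> \<epsilon>"
        by (simp add: G_def dist_norm)
      moreover have "linear (\<lambda>v. D y' v - D y v)"
        by (intro linear_compose_sub linear_derivative)
      ultimately show "onorm (\<lambda>v. D y' v - D y v) \<le> \<epsilon>"
        by (intro onorm_le order.trans[OF norm_linear_le_sum_Basis] mult_right_mono) auto
    qed (use z \<delta> in \<open>auto simp: dist_norm\<close>)
    then show ?thesis
      by (simp add: linear_add[OF linear_derivative] algebra_simps)
  qed
  with \<delta>(1) show ?thesis by (rule that)
qed

end

section \<open>Convex combinations of controls and a supporting functional\<close>

definition control :: "'a::euclidean_space set \<Rightarrow> real \<Rightarrow> (real \<Rightarrow> 'a) \<Rightarrow> bool" where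
  "control U T h \<longleftrightarrow> h \<in> borel_measurable (lebesgue_on {0..T}) \<and> (\<forall>t\<in>{0..T}. h t \<in> U)"

lemma control_subinterval:
  assumes "control U T h" "T' \<le> T"
  shows "control U T' h"
proof -
  have "h \<in> borel_measurable (lebesgue_on {0..T'})"
    by (rule measurable_restrict_mono[of h lebesgue "{0..T}"]) (use assms in \<open>auto simp: control_def\<close>)
  then show ?thesis using assms by (simp add: control_def)
qed

lemma control_convex_combination:
  assumes U: "convex U" and h: "control U T h" and w: "\<And>p. p \<in> I \<Longrightarrow> control U T (w p)"
    and I: "finite I" "\<And>p. p \<in> I \<Longrightarrow> 0 \<le> a p" "sum a I \<le> 1"
  shows "control U T (\<lambda>t. h t + (\<Sum>p\<in>I. a p *\<^sub>R (w p t - h t)))"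
  unfolding control_def
proof safe
  show "(\<lambda>t. h t + (\<Sum>p\<in>I. a p *\<^sub>R (w p t - h t))) \<in> borel_measurable (lebesgue_on {0..T})"
    using h w by (intro borel_measurable_add borel_measurable_sum borel_measurable_scaleR
        borel_measurable_diff borel_measurable_const) (auto simp: control_def)
  fix t assume t: "t \<in> {0..T}"
  \<comment> \<open>\<open>None\<close> stands for the reference control \<open>h\<close>, which
    takes the weight left over by the variations \<open>Some p\<close>.\<close>
  define b where "b = case_option (1 - sum a I) a"
  define z where "z = case_option (h t) (\<lambda>p. w p t)"
  have "(\<Sum>j\<in>insert None (Some ` I). b j *\<^sub>R z j) \<in> U"
  proof (rule convex_sum[OF _ U])
    show "sum b (insert None (Some ` I)) = 1"
      using I(1) by (simp add: b_def sum.reindex)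
    show "0 \<le> b j" if "j \<in> insert None (Some ` I)" for j
      using that I by (auto simp: b_def)
    show "z j \<in> U" if "j \<in> insert None (Some ` I)" for j
      using that h w t by (auto simp: z_def control_def)
  qed (use I in auto)
  also have "(\<Sum>j\<in>insert None (Some ` I). b j *\<^sub>R z j) = h t + (\<Sum>p\<in>I. a p *\<^sub>R (w p t - h t))"
    using I(1) by (simp add: b_def z_def sum.reindex scaleR_diff_right sum_subtractf
        scaleR_diff_left flip: scaleR_sum_left)
  finally show "h t + (\<Sum>p\<in>I. a p *\<^sub>R (w p t - h t)) \<in> U" .
qed

lemma norm_le_DIM_mult:
  fixes v :: "'a::euclidean_space" and c :: real
  assumes "\<And>e. e \<in> Basis \<Longrightarrow> \<bar>v \<bullet> e\<bar> \<le> c"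
  shows "norm v \<le> real DIM('a) * c"
  by (rule order.trans[OF norm_le_l1 sum_bounded_above]) (rule assms)

text \<open>A convex set with empty interior lies in a hyperplane, which passes through 0 because 0
  is in \<open>K\<close>. Otherwise 0 is separated from the interior, and the inequality extends to
  its closure, which contains \<open>K\<close>.\<close>

lemma convex_supporting_at_0:
  fixes K :: "'a::euclidean_space set"
  assumes "convex K" "0 \<in> K" "0 \<notin> interior K"
  obtains c where "c \<noteq> 0" "\<And>k. k \<in> K \<Longrightarrow> c \<bullet> k \<le> 0"
proof (cases "interior K = {}")
  case True
  then obtain a b where ab: "a \<noteq> 0" "K \<subseteq> {x. a \<bullet> x = b}"
    using empty_interior_subset_hyperplane[OF \<open>convex K\<close>] by metis
  then have "b = 0" using \<open>0 \<in> K\<close> by auto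
  then have "a \<bullet> k \<le> 0" if "k \<in> K" for k using ab that by auto
  with ab(1) show ?thesis by (rule that)
next
  case False
  obtain a where a: "a \<noteq> 0" "\<And>k. k \<in> interior K \<Longrightarrow> 0 \<le> a \<bullet> k"
    using separating_hyperplane_set_0[OF convex_interior[OF \<open>convex K\<close>] assms(3)] by blast
  have "K \<subseteq> closure (interior K)"
    using convex_closure_interior[OF \<open>convex K\<close> False] closure_subset by blast
  also have "\<dots> \<subseteq> {k. a \<bullet> k \<ge> 0}"
    by (rule closure_minimal) (use a in \<open>auto simp: closed_halfspace_ge\<close>)
  finally show ?thesis
    by (intro that[of "- a"]) (use a in auto)
qed

section \<open>Early arrival and the maximum condition\<close>

context c1_field
begin

text \<open>
  If the first-order variations \<open>w (e, \<plusminus>1)\<close> move the endpoint in the directions \<open>\<plusminus>e\<close>, their convex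
  combinations realise every small displacement \<open>y\<close> of the endpoint up to an error below \<open>norm y / 2\<close>.
  Shortening the time by a little costs another \<open>norm y / 2\<close>, and Brouwer's theorem hits the old
  endpoint exactly.
\<close>

lemma reach_earlier:
  assumes U: "convex U" "bounded U" and T_pos: "0 < T" and h: "control U T h"
    and x: "controlled_solution f T h x"
    and ode: "linear_ode (\<lambda>t. D (x t)) T K"
    and m: "\<And>e. e \<in> Basis \<Longrightarrow> m e T = e"
      "\<And>e. e \<in> Basis \<Longrightarrow> linear_ode.adjoint_solution (\<lambda>t. D (x t)) T (m e)"
    and r: "0 < r"
    and w: "\<And>p. p \<in> Basis \<times> {1, -1 :: real} \<Longrightarrow> control U T (w p)"
    and eff: "\<And>p e. p \<in> Basis \<times> {1, -1} \<Longrightarrow> e \<in> Basis \<Longrightarrow>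
       integral {0..T} (\<lambda>t. m e t \<bullet> (w p t - h t)) = r * (snd p * (fst p \<bullet> e))"
  shows "\<exists>T' W X. 0 < T' \<and> T' < T \<and> control U T' W \<and> controlled_solution f T' W X \<and> X 0 = x 0 \<and> X T' = x T"
proof -
  interpret linear_ode "\<lambda>t. D (x t)" T K by (rule ode)
  obtain M where M: "0 < M" "\<And>u. u \<in> U \<Longrightarrow> norm u \<le> M"
    using U(2) unfolding bounded_pos by blast
  have cM: "norm (w t) \<le> M" if "control U T w" "t \<in> {0..T}" for w t
    using that M(2) by (auto simp: control_def)
  have cmeas: "w \<in> borel_measurable (lebesgue_on {0..T})" if "control U T w" for w
    using that by (simp add: control_def)
  have cint: "w integrable_on {0..T}" if "control U T w" for w
    by (rule bounded_measurable_integrable_on[OF cmeas cM]) (use that in auto)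
  have xc: "continuous_on {0..T} x"
    using x T by (intro controlled_solution_continuous) auto
  obtain R where R: "0 < R" "\<And>t. t \<in> {0..T} \<Longrightarrow> norm (x t) \<le> R"
    by (rule continuous_on_interval_norm_bound[OF xc], rule that)
  obtain F L B where L: "0 < L" and lip: "\<And>y z. norm (F y - F z) \<le> L * norm (y - z)"
    and B: "\<And>y. norm (F y) \<le> B" and Ff: "\<And>y. norm y \<le> R + 1 \<Longrightarrow> F y = f y"
    by (rule clamped_field[of "R + 1"], (use R in simp)[1], rule that)
  have Fc: "continuous_on S F" for S
    by (rule lipschitz_imp_continuous_on[OF _ lip]) (use L in auto)
  have B0: "0 \<le> B" using B[of 0] by (rule order.trans[OF norm_ge_zero])

  define I where "I = (Basis :: 'a set) \<times> {1, -1 :: real}"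
  define N where "N = real (card I)"
  have I: "finite I" "I \<noteq> {}" by (auto simp: I_def)
  have N: "0 < N" using I by (simp add: N_def card_gt_0_iff)
  \<comment> \<open>Weights must be nonnegative, so each coordinate of \<open>y\<close> is split
    into positive and negative parts, carried by the two variations along that axis. Since
    \<open>max 0 s - max 0 (- s) = s\<close>, the combined first-order effect is exactly
    \<open>y\<close>; the division by \<open>r\<close> normalises the effect of each
    variation.\<close>
  define \<alpha> where "\<alpha> p y = max 0 (snd p * (y \<bullet> fst p)) / r" for p :: "'a \<times> real" and y
  have \<alpha>0: "0 \<le> \<alpha> p y" "\<alpha> p 0 = 0" for p y using r by (auto simp: \<alpha>_def)
  have \<alpha>lip: "\<bar>\<alpha> p y - \<alpha> p z\<bar> \<le> norm (y - z) / r" if "p \<in> I" for p y z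
  proof -
    have "\<bar>max 0 (snd p * (y \<bullet> fst p)) - max 0 (snd p * (z \<bullet> fst p))\<bar> \<le> \<bar>snd p * (y \<bullet> fst p) - snd p * (z \<bullet> fst p)\<bar>"
      by linarith
    also have "\<dots> = \<bar>(y - z) \<bullet> fst p\<bar>"
      using that by (auto simp: I_def inner_diff_left)
    also have "\<dots> \<le> norm (y - z)"
      using that by (auto simp: I_def intro!: Basis_le_norm)
    finally show ?thesis
      using r by (simp add: \<alpha>_def divide_right_mono flip: diff_divide_distrib)
  qed
  define W where "W y t = h t + (\<Sum>p\<in>I. \<alpha> p y *\<^sub>R (w p t - h t))" for y t
  have W0: "W 0 = h" by (simp add: fun_eq_iff W_def \<alpha>0)
  \<comment> \<open>For \<open>norm y \<le> \<rho>0\<close> each of the \<open>N\<close> weights is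
    at most \<open>1 / N\<close>, so the combination stays convex.\<close>
  define \<rho>0 where "\<rho>0 = r / N"
  have \<rho>0: "0 < \<rho>0" using r N by (simp add: \<rho>0_def)
  have W: "control U T (W y)" if "norm y \<le> \<rho>0" for y
    unfolding W_def
  proof (rule control_convex_combination[OF U(1) h])
    have "(\<Sum>p\<in>I. \<alpha> p y) \<le> N * (norm y / r)"
      unfolding N_def using \<alpha>lip[of _ y 0] \<alpha>0 by (intro sum_bounded_above) force
    also have "\<dots> \<le> N * (\<rho>0 / r)"
      using that N r by (intro mult_left_mono divide_right_mono) auto
    also have "\<dots> = 1" using N r by (simp add: \<rho>0_def)
    finally show "(\<Sum>p\<in>I. \<alpha> p y) \<le> 1" .
  qed (use w \<alpha>0 I in \<open>auto simp: I_def\<close>)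
  \<comment> \<open>A Lipschitz constant of the varied trajectory in \<open>y\<close>:
    \<open>N\<close> weights with slope \<open>1 / r\<close>, control differences of size
    \<open>2 * M\<close>, duration \<open>T\<close>, and the Gronwall factor.\<close>
  define C where "C = N * (2 * M) / r * T * exp (L * T)"
  have C: "0 \<le> C" using N M r T by (simp add: C_def)
  have Wlip: "norm (integral {0..t} (\<lambda>s. W y s - W z s)) \<le> N * (2 * M) / r * T * norm (y - z)"
    if y: "norm y \<le> \<rho>0" and z: "norm z \<le> \<rho>0" and t: "t \<in> {0..T}" for y z t
  proof -
    have "norm (integral {0..t} (\<lambda>s. W y s - W z s)) \<le> integral {0..t} (\<lambda>s. N * (norm (y - z) / r * (2 * M)))"
    proof (rule integral_norm_bound_integral)
      show "(\<lambda>s. W y s - W z s) integrable_on {0..t}"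
        using t by (intro integrable_diff integrable_on_subinterval[OF cint[OF W]] y z) auto
      fix s assume "s \<in> {0..t}"
      then have s: "s \<in> {0..T}" using t by auto
      have "W y s - W z s = (\<Sum>p\<in>I. (\<alpha> p y - \<alpha> p z) *\<^sub>R (w p s - h s))"
        by (simp add: W_def scaleR_diff_left sum_subtractf)
      also have "norm \<dots> \<le> (\<Sum>p\<in>I. norm (y - z) / r * (2 * M))"
      proof (rule sum_norm_le)
        fix p assume p: "p \<in> I"
        have "norm (w p s - h s) \<le> 2 * M"
          using norm_triangle_ineq4[of "w p s" "h s"] cM[OF h s] cM[OF w s, of p] p
          by (auto simp: I_def)
        then show "norm ((\<alpha> p y - \<alpha> p z) *\<^sub>R (w p s - h s)) \<le> norm (y - z) / r * (2 * M)"
          unfolding norm_scaleR using \<alpha>lip[OF p, of y z] r by (intro mult_mono) auto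
      qed
      finally show "norm (W y s - W z s) \<le> N * (norm (y - z) / r * (2 * M))"
        by (simp add: N_def)
    qed auto
    also have "\<dots> = t * (N * (norm (y - z) / r * (2 * M)))"
      using t by simp
    also have "\<dots> \<le> T * (N * (norm (y - z) / r * (2 * M)))"
      using t N M r by (intro mult_right_mono) auto
    finally show ?thesis by (simp add: mult_ac)
  qed

  have "\<exists>X. X 0 = x 0 \<and> controlled_solution F T (W y) X" if "norm y \<le> \<rho>0" for y
    using controlled_solution_exists[OF _ _ lip cint[OF W[OF that]], of "x 0"] T L by (metis less_imp_le)
  then obtain X where X0: "\<And>y. norm y \<le> \<rho>0 \<Longrightarrow> X y 0 = x 0"
    and X: "\<And>y. norm y \<le> \<rho>0 \<Longrightarrow> controlled_solution F T (W y) (X y)"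
    by metis
  have Xlip: "norm (X y t - X z t) \<le> C * norm (y - z)"
    if y: "norm y \<le> \<rho>0" and z: "norm z \<le> \<rho>0" and t: "t \<in> {0..T}" for y z t
    using controlled_solution_stable[OF _ lip X[OF y] X[OF z] _ cint[OF W[OF y]] cint[OF W[OF z]] Wlip[OF y z] t]
      X0 y z L by (simp add: C_def mult_ac)
  have xF: "controlled_solution F T h x"
    by (rule controlled_solution_cong[OF x]) (use R(2) Ff in force)
  have Xx: "norm (X y t - x t) \<le> C * norm y" if y: "norm y \<le> \<rho>0" and t: "t \<in> {0..T}" for y t
    using controlled_solution_stable[OF _ lip X[OF y] xF _ cint[OF W[OF y]] cint[OF h] Wlip[OF y, of 0, unfolded W0] t]
      X0 y L \<rho>0 by (simp add: C_def mult_ac)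

  have mc: "continuous_on {0..T} (m e)" if "e \<in> Basis" for e
    using m(2)[OF that] by (rule adjoint_solution_continuous)
  have "\<exists>b. \<forall>t\<in>{0..T}. norm (m e t) \<le> b" if "e \<in> Basis" for e
    using continuous_on_interval_norm_bound[OF mc[OF that]] by metis
  then obtain b where b: "\<And>e t. e \<in> Basis \<Longrightarrow> t \<in> {0..T} \<Longrightarrow> norm (m e t) \<le> b e" by metis
  define \<Lambda> where "\<Lambda> = (\<Sum>e\<in>Basis. b e)"
  have \<Lambda>: "norm (m e t) \<le> \<Lambda>" if "e \<in> Basis" "t \<in> {0..T}" for e t
  proof -
    have "0 \<le> b e'" if "e' \<in> Basis" for e'
      using b[OF that \<open>t \<in> {0..T}\<close>] by (rule order.trans[OF norm_ge_zero])
    then have "b e \<le> \<Lambda>" unfolding \<Lambda>_def using that by (intro member_le_sum) auto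
    with b[OF that] show ?thesis by simp
  qed
  have \<Lambda>0: "0 \<le> \<Lambda>"
    using \<Lambda>[OF SOME_Basis, of 0] T by (auto intro: order.trans[OF norm_ge_zero])

  \<comment> \<open>Chosen so that the sum of the coordinate errors,
    \<open>DIM('a) * (\<Lambda> * C * T) / d * norm y\<close>, is at most half of
    \<open>norm y\<close>; the summand 1 keeps \<open>d\<close> positive.\<close>
  define d where "d = 2 * (DIM('a) * (\<Lambda> * C * T) + 1)"
  have d: "0 < d" using \<Lambda>0 C T by (simp add: d_def add_nonneg_pos)
  obtain \<delta> where \<delta>: "0 < \<delta>"
    "\<And>y z. norm y \<le> R \<Longrightarrow> norm z \<le> \<delta> \<Longrightarrow> norm (f (y + z) - f y - D y z) \<le> 1 / d * norm z"
    by (rule uniform_linearization[of "1 / d" R], (use d in simp)[1], rule that)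
  \<comment> \<open>The three bounds make the control admissible, keep the deviation from
    \<open>x\<close> within the range of the linearisation, and keep the trajectory within radius
    \<open>R + 1\<close>, where \<open>F\<close> and \<open>f\<close> agree.\<close>
  define \<rho> where "\<rho> = min \<rho>0 (min (\<delta> / (C + 1)) (1 / (C + 1)))"
  have \<rho>: "0 < \<rho>" "\<rho> \<le> \<rho>0" using \<rho>0 \<delta> C by (auto simp: \<rho>_def)
  have C\<rho>: "C * norm y \<le> \<delta>" "C * norm y \<le> 1" if "norm y \<le> \<rho>" for y
  proof -
    have "norm y \<le> \<delta> / (C + 1)" "norm y \<le> 1 / (C + 1)" using that by (auto simp: \<rho>_def)
    then have "(C + 1) * norm y \<le> \<delta>" "(C + 1) * norm y \<le> 1"
      using C by (auto simp: pos_le_divide_eq mult.commute)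
    then show "C * norm y \<le> \<delta>" "C * norm y \<le> 1"
      by (auto simp: distrib_right intro: order.trans[rotated])
  qed
  have first_order: "norm (X y T - x T - y) \<le> norm y / 2" if y: "norm y \<le> \<rho>" for y
  proof -
    have y0: "norm y \<le> \<rho>0" using y \<rho> by simp
    have comp: "\<bar>(X y T - x T - y) \<bullet> e\<bar> \<le> \<Lambda> * (1 / d * (C * norm y)) * T" if e: "e \<in> Basis" for e
    proof -
      have mi: "(\<lambda>t. m e t \<bullet> (w p t - h t)) integrable_on {0..T}" if "p \<in> I" for p
        using that inner_integrable_on[OF mc[OF e] cmeas[OF w] cM[OF w], of p]
          inner_integrable_on[OF mc[OF e] cmeas[OF h] cM[OF h]]
        by (auto simp: inner_diff_right I_def intro!: integrable_diff)
      have "integral {0..T} (\<lambda>t. m e t \<bullet> (W y t - h t))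
          = integral {0..T} (\<lambda>t. \<Sum>p\<in>I. \<alpha> p y * (m e t \<bullet> (w p t - h t)))"
        by (simp add: W_def inner_sum_right)
      also have "\<dots> = (\<Sum>p\<in>I. \<alpha> p y * integral {0..T} (\<lambda>t. m e t \<bullet> (w p t - h t)))"
        using I(1) mi by (subst integral_sum) (auto intro: integrable_on_mult_right)
      also have "\<dots> = (\<Sum>p\<in>I. \<alpha> p y * (r * (snd p * (fst p \<bullet> e))))"
        using eff[OF _ e] by (intro sum.cong) (auto simp: I_def)
      also have "\<dots> = (\<Sum>b\<in>Basis. (y \<bullet> b) * (b \<bullet> e))"
        unfolding I_def sum.cartesian_product' using r
        by (intro sum.cong) (auto simp: \<alpha>_def max_def)
      also have "\<dots> = y \<bullet> e"
        using euclidean_inner[of y e] by (simp add: inner_commute[of e])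
      finally have eq: "integral {0..T} (\<lambda>t. m e t \<bullet> (W y t - h t)) = y \<bullet> e" .
      \<comment> \<open>With \<open>m e T = e\<close> the boundary term is the coordinate of the
        endpoint displacement and the control integral is \<open>y \<bullet> e\<close>. Their
        difference is therefore the integrated linearisation error.\<close>
      have "((\<lambda>t. m e t \<bullet> (F (X y t) - F (x t) - D (x t) (X y t - x t))) has_integral
          m e T \<bullet> (X y T - x T) - integral {0..T} (\<lambda>t. m e t \<bullet> (W y t - h t))) (cbox 0 T)"
        unfolding box_real
        by (rule adjoint_duality[OF m(2)[OF e] Fc X[OF y0] xF X0[OF y0] cmeas[OF W[OF y0]] cM[OF W[OF y0]] cmeas[OF h] cM[OF h]])
      then have "norm (m e T \<bullet> (X y T - x T) - integral {0..T} (\<lambda>t. m e t \<bullet> (W y t - h t)))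
          \<le> \<Lambda> * (1 / d * (C * norm y)) * measure lborel (cbox 0 T)"
      proof (rule has_integral_bound[rotated])
        fix t assume "t \<in> cbox 0 T"
        then have t: "t \<in> {0..T}" by simp
        define z where "z = X y t - x t"
        have z: "norm z \<le> C * norm y" unfolding z_def by (rule Xx[OF y0 t])
        have "norm (x t + z) \<le> R + 1"
          using norm_triangle_ineq[of "x t" z] R(2)[OF t] z C\<rho>(2)[OF y] by linarith
        then have "F (X y t) = f (x t + z)" using Ff[of "x t + z"] by (simp add: z_def)
        moreover have "F (x t) = f (x t)" using R(2)[OF t] by (intro Ff) simp
        ultimately have "norm (F (X y t) - F (x t) - D (x t) (X y t - x t)) \<le> 1 / d * norm z"
          using \<delta>(2)[OF R(2)[OF t], of z] z C\<rho>(1)[OF y] by (simp add: z_def)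
        also have "\<dots> \<le> 1 / d * (C * norm y)" using z d by (intro mult_left_mono) auto
        finally have "norm (F (X y t) - F (x t) - D (x t) (X y t - x t)) \<le> 1 / d * (C * norm y)" .
        then show "norm (m e t \<bullet> (F (X y t) - F (x t) - D (x t) (X y t - x t))) \<le> \<Lambda> * (1 / d * (C * norm y))"
          unfolding real_norm_def using \<Lambda>[OF e t] \<Lambda>0
          by (intro order.trans[OF Cauchy_Schwarz_ineq2] mult_mono) auto
      qed (use \<Lambda>0 C d in auto)
      then show ?thesis
        unfolding eq using T by (simp add: m(1)[OF e] inner_diff_left inner_diff_right inner_commute)
    qed
    have "norm (X y T - x T - y) \<le> DIM('a) * (\<Lambda> * (1 / d * (C * norm y)) * T)"
      by (rule norm_le_DIM_mult, rule comp)
    also have "\<dots> = (DIM('a) * (\<Lambda> * C * T)) / d * norm y" by simp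
    also have "\<dots> \<le> 1 / 2 * norm y"
      by (rule mult_right_mono) (use d in \<open>auto simp: d_def field_simps\<close>)
    finally show ?thesis by simp
  qed

  define B1 where "B1 = B + M"
  have B1: "0 < B1" using B0 M by (simp add: B1_def)
  \<comment> \<open>\<open>B1\<close> bounds the speed, so this cut moves the endpoint by at most
    \<open>\<rho> / 2\<close>; the bound \<open>T / 2\<close> keeps \<open>T'\<close>
    positive.\<close>
  define T' where "T' = T - min (T / 2) (\<rho> / (2 * B1))"
  have T': "0 < T'" "T' < T" "T - T' \<le> \<rho> / (2 * B1)" using T_pos \<rho> B1 by (auto simp: T'_def min_def)
  have T'in: "T' \<in> {0..T}" using T' by auto
  \<comment> \<open>A fixed point of \<open>G\<close> is a parameter whose trajectory is at
    \<open>x T\<close> already at time \<open>T'\<close>. \<open>G\<close> maps the ball to itself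
    because the early stop and the first-order error contribute at most \<open>\<rho> / 2\<close>
    each.\<close>
  define G where "G y = y - (X y T' - x T)" for y
  have "continuous_on (cball 0 \<rho>) G"
  proof -
    have "continuous_on (cball 0 \<rho>) (\<lambda>y. X y T')"
      by (rule lipschitz_on_continuous_on[of C], rule lipschitz_onI)
        (use Xlip[OF _ _ T'in] \<rho> C in \<open>auto simp: dist_norm\<close>)
    then show ?thesis unfolding G_def by (intro continuous_intros)
  qed
  moreover have "G \<in> cball 0 \<rho> \<rightarrow> cball 0 \<rho>"
  proof
    fix y :: 'a assume "y \<in> cball 0 \<rho>"
    then have y: "norm y \<le> \<rho>" and y0: "norm y \<le> \<rho>0" using \<rho> by auto
    have "norm (X y T - X y T') \<le> B1 * (T - T')"
    proof (rule controlled_solution_time_lipschitz[OF X[OF y0]])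
      show "norm (F (X y t) + W y t) \<le> B1" if "t \<in> {0..T}" for t
        using norm_triangle_ineq[of "F (X y t)" "W y t"] B[of "X y t"] cM[OF W[OF y0] that]
        by (simp add: B1_def)
    qed (use T' in auto)
    also have "\<dots> \<le> B1 * (\<rho> / (2 * B1))" using T'(3) B1 by (intro mult_left_mono) auto
    also have "\<dots> = \<rho> / 2" using B1 by simp
    finally have "norm (X y T - X y T') \<le> \<rho> / 2" .
    moreover have "G y = (X y T - X y T') - (X y T - x T - y)" by (simp add: G_def)
    ultimately show "G y \<in> cball 0 \<rho>"
      using first_order[OF y] y norm_triangle_ineq4[of "X y T - X y T'" "X y T - x T - y"] by simp
  qed
  ultimately obtain y where y: "y \<in> cball 0 \<rho>" "G y = y"
    using brouwer[of "cball 0 \<rho>" G] \<rho> by auto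
  then have y\<rho>: "norm y \<le> \<rho>" and y0: "norm y \<le> \<rho>0" using \<rho> by auto
  have "controlled_solution f T (W y) (X y)"
  proof (rule controlled_solution_cong[OF X[OF y0]])
    fix t assume t: "t \<in> {0..T}"
    have "norm (X y t) \<le> R + 1"
      using norm_triangle_sub[of "X y t" "x t"] Xx[OF y0 t] C\<rho>(2)[OF y\<rho>] R(2)[OF t] by linarith
    then show "F (X y t) = f (X y t)" by (rule Ff)
  qed
  then have "controlled_solution f T' (W y) (X y)"
    by (rule controlled_solution_subinterval) (use T' in simp)
  moreover have "control U T' (W y)"
    by (rule control_subinterval[OF W[OF y0]]) (use T' in simp)
  moreover have "X y T' = x T" using y(2) by (simp add: G_def)
  ultimately show ?thesis using T' X0[OF y0] by blast
qed

theorem maximum_principle: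
  assumes U: "convex U" "bounded U" and T_pos: "0 < T" and h: "control U T h"
    and x: "controlled_solution f T h x"
    and optimal: "\<And>T' w X. 0 < T' \<Longrightarrow> control U T' w \<Longrightarrow> controlled_solution f T' w X \<Longrightarrow>
      X 0 = x 0 \<Longrightarrow> X T' = x T \<Longrightarrow> T \<le> T'"
  obtains \<mu> where "\<And>t. t \<in> {0..T} \<Longrightarrow> \<mu> t \<noteq> 0"
    and "\<And>t. t \<in> {0..T} \<Longrightarrow> (\<mu> has_vector_derivative - adjoint (D (x t)) (\<mu> t)) (at t within {0..T})"
    and "\<And>w. control U T w \<Longrightarrow> integral {0..T} (\<lambda>t. \<mu> t \<bullet> (w t - h t)) \<le> 0"
proof -
  have xc: "continuous_on {0..T} x"
    using x T_pos by (intro controlled_solution_continuous) auto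
  obtain R where R: "\<And>t. t \<in> {0..T} \<Longrightarrow> norm (x t) \<le> R"
    by (rule continuous_on_interval_norm_bound[OF xc], rule that)
  obtain K where K: "0 < K" "\<And>y v. norm y \<le> R \<Longrightarrow> norm (D y v) \<le> K * norm v"
    by (rule derivative_bound[of R], rule that)
  interpret linear_ode "\<lambda>t. D (x t)" T K
    by (rule linear_ode.intro)
      (use T_pos R K linear_derivative continuous_on_derivative_compose[OF xc] in auto)
  obtain M where M: "\<And>u. u \<in> U \<Longrightarrow> norm u \<le> M"
    using U(2) unfolding bounded_iff by blast
  have "\<exists>\<mu>. \<mu> T = e \<and> adjoint_solution \<mu>" for e
    using adjoint_solution_exists by metis
  then obtain m where m: "\<And>e. m e T = e" "\<And>e. adjoint_solution (m e)" by metis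
  have int: "(\<lambda>t. m e t \<bullet> (w t - h t)) integrable_on {0..T}" if "control U T w" for w e
    unfolding inner_diff_right
    by (intro integrable_diff inner_integrable_on[where M = M] adjoint_solution_continuous m)
      (use that h M in \<open>auto simp: control_def\<close>)
  \<comment> \<open>The endpoint of the linearised system under the variation \<open>w - h\<close>,
    assembled from its coordinates by duality.\<close>
  define \<kappa> where "\<kappa> w = (\<Sum>e\<in>Basis. integral {0..T} (\<lambda>t. m e t \<bullet> (w t - h t)) *\<^sub>R e)" for w
  define S where "S = \<kappa> ` {w. control U T w}"
  have "convex S"
    unfolding convex_def
  proof safe
    fix k l and a b :: real assume "k \<in> S" "l \<in> S" and ab: "0 \<le> a" "0 \<le> b" "a + b = 1"
    then obtain w z where w: "control U T w" "k = \<kappa> w" and z: "control U T z" "l = \<kappa> z"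
      by (auto simp: S_def)
    have "control U T (\<lambda>t. a *\<^sub>R w t + b *\<^sub>R z t)"
      using w z U(1) ab by (auto simp: control_def convex_def)
    moreover have "integral {0..T} (\<lambda>t. m e t \<bullet> (a *\<^sub>R w t + b *\<^sub>R z t - h t))
        = a * integral {0..T} (\<lambda>t. m e t \<bullet> (w t - h t)) + b * integral {0..T} (\<lambda>t. m e t \<bullet> (z t - h t))" for e
    proof -
      have "a *\<^sub>R w t + b *\<^sub>R z t - h t = a *\<^sub>R (w t - h t) + b *\<^sub>R (z t - h t)" for t
        using ab(3) by (simp add: algebra_simps flip: scaleR_add_left)
      then have "integral {0..T} (\<lambda>t. m e t \<bullet> (a *\<^sub>R w t + b *\<^sub>R z t - h t))
          = integral {0..T} (\<lambda>t. a * (m e t \<bullet> (w t - h t)) + b * (m e t \<bullet> (z t - h t)))"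
        by (simp add: inner_add_right)
      then show ?thesis
        using int[OF w(1)] int[OF z(1)] by (simp add: integral_add integrable_on_mult_right)
    qed
    then have "\<kappa> (\<lambda>t. a *\<^sub>R w t + b *\<^sub>R z t) = a *\<^sub>R k + b *\<^sub>R l"
      by (simp add: \<kappa>_def w z scaleR_add_left scaleR_sum_right sum.distrib)
    ultimately show "a *\<^sub>R k + b *\<^sub>R l \<in> S" by (force simp: S_def)
  qed
  moreover have "0 \<in> S"
    using h by (force simp: S_def \<kappa>_def)
  moreover have "0 \<notin> interior S"
  proof
    assume "0 \<in> interior S"
    then obtain r where r: "0 < r" "cball 0 r \<subseteq> S"
      by (auto simp: mem_interior_cball)
    have "\<exists>w. control U T w \<and> \<kappa> w = (r * snd p) *\<^sub>R fst p" if "p \<in> Basis \<times> {1, -1}" for p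
    proof -
      have "(r * snd p) *\<^sub>R fst p \<in> cball 0 r" using that r(1) by auto
      with r(2) have "(r * snd p) *\<^sub>R fst p \<in> \<kappa> ` {w. control U T w}" by (auto simp: S_def)
      then show ?thesis by (metis imageE mem_Collect_eq)
    qed
    then obtain w where w: "\<And>p. p \<in> Basis \<times> {1, -1} \<Longrightarrow> control U T (w p)"
      "\<And>p. p \<in> Basis \<times> {1, -1} \<Longrightarrow> \<kappa> (w p) = (r * snd p) *\<^sub>R fst p"
      by metis
    have "\<exists>T' W X. 0 < T' \<and> T' < T \<and> control U T' W \<and> controlled_solution f T' W X \<and> X 0 = x 0 \<and> X T' = x T"
    proof (rule reach_earlier[OF U T_pos h x linear_ode_axioms m r(1) w(1)])
      fix p :: "'a \<times> real" and e :: 'a assume "p \<in> Basis \<times> {1, -1 :: real}" and e: "e \<in> Basis"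
      then have "\<kappa> (w p) \<bullet> e = r * (snd p * (fst p \<bullet> e))" by (simp add: w)
      moreover have "\<kappa> (w p) \<bullet> e = integral {0..T} (\<lambda>t. m e t \<bullet> (w p t - h t))"
        using e by (simp add: \<kappa>_def)
      ultimately show "integral {0..T} (\<lambda>t. m e t \<bullet> (w p t - h t)) = r * (snd p * (fst p \<bullet> e))" by simp
    qed
    with optimal show False by (meson not_less)
  qed
  ultimately obtain c where c: "c \<noteq> 0" "\<And>k. k \<in> S \<Longrightarrow> c \<bullet> k \<le> 0"
    by (rule convex_supporting_at_0) (rule that)
  \<comment> \<open>By linearity this is the adjoint solution ending at the normal \<open>c\<close>,
    and its pairing with \<open>w - h\<close> integrates to
    \<open>c \<bullet> \<kappa> w\<close>.\<close>
  define \<mu> where "\<mu> t = (\<Sum>e\<in>Basis. (c \<bullet> e) *\<^sub>R m e t)" for t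
  have adj: "adjoint_solution \<mu>"
    unfolding adjoint_solution_def
  proof
    fix t assume t: "t \<in> {0..T}"
    have "linear (adjoint (D (x t)))" by (intro adjoint_linear linear_derivative)
    then have "- adjoint (D (x t)) (\<mu> t) = (\<Sum>e\<in>Basis. (c \<bullet> e) *\<^sub>R - adjoint (D (x t)) (m e t))"
      by (simp add: \<mu>_def linear_sum linear_cmul sum_negf)
    moreover have "(\<mu> has_vector_derivative (\<Sum>e\<in>Basis. (c \<bullet> e) *\<^sub>R - adjoint (D (x t)) (m e t))) (at t within {0..T})"
      unfolding \<mu>_def
      using m(2) t by (intro has_vector_derivative_sum bounded_linear.has_vector_derivative[OF bounded_linear_scaleR_right])
        (auto simp: adjoint_solution_def)
    ultimately show "(\<mu> has_vector_derivative - adjoint (D (x t)) (\<mu> t)) (at t within {0..T})" by simp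
  qed
  show ?thesis
  proof (rule that)
    have "\<mu> T = c" by (simp add: \<mu>_def m euclidean_representation)
    then show "\<mu> t \<noteq> 0" if "t \<in> {0..T}" for t
      using adjoint_solution_nonzero[OF adj _ that] c(1) by simp
    show "(\<mu> has_vector_derivative - adjoint (D (x t)) (\<mu> t)) (at t within {0..T})" if "t \<in> {0..T}" for t
      using adj that by (simp add: adjoint_solution_def)
    fix w assume w: "control U T w"
    have "integral {0..T} (\<lambda>t. \<mu> t \<bullet> (w t - h t)) = integral {0..T} (\<lambda>t. \<Sum>e\<in>Basis. (c \<bullet> e) * (m e t \<bullet> (w t - h t)))"
      by (simp add: \<mu>_def inner_sum_left)
    also have "\<dots> = (\<Sum>e\<in>Basis. (c \<bullet> e) * integral {0..T} (\<lambda>t. m e t \<bullet> (w t - h t)))"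
      using int[OF w] by (subst integral_sum) (auto intro: integrable_on_mult_right)
    also have "\<dots> = c \<bullet> \<kappa> w"
      by (simp add: \<kappa>_def inner_sum_right mult.commute)
    also have "\<dots> \<le> 0" using c(2) w by (auto simp: S_def)
    finally show "integral {0..T} (\<lambda>t. \<mu> t \<bullet> (w t - h t)) \<le> 0" .
  qed
qed

end

section \<open>Zeros of solutions of the linearised chain\<close>

text \<open>A form of l'Hospital's rule for orders of vanishing: integration raises the order by one
  and divides the leading coefficient by the new order. Derivatives are taken within the interval,
  so \<open>s\<close> may be one of its endpoints.\<close>

lemma tendsto_power_quotient_integrate:
  fixes g g' :: "real \<Rightarrow> real"
  assumes der: "\<And>t. t \<in> {a..b} \<Longrightarrow> (g has_real_derivative g' t) (at t within {a..b})"
    and s: "s \<in> {a..b}" "g s = 0"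
    and lim: "((\<lambda>t. g' t / (t - s) ^ m) \<longlongrightarrow> \<rho>) (at s within {a..b})"
  shows "((\<lambda>t. g t / (t - s) ^ Suc m) \<longlongrightarrow> \<rho> / Suc m) (at s within {a..b})"
proof (rule tendstoI)
  fix \<epsilon> :: real assume "0 < \<epsilon>"
  \<comment> \<open>Removing the expected leading term leaves a derivative that is small compared
    with \<open>(t - s) ^ m\<close>; the mean value theorem transfers this to
    \<open>G\<close>.\<close>
  define G where "G t = g t - \<rho> / Suc m * (t - s) ^ Suc m" for t
  have dG: "(G has_real_derivative g' t - \<rho> * (t - s) ^ m) (at t within {a..b})" if "t \<in> {a..b}" for t
    unfolding G_def using der[OF that]
    by (auto intro!: derivative_eq_intros simp del: power_Suc)
  have dG_sub: "(G has_derivative (*) (g' t - \<rho> * (t - s) ^ m)) (at t within {c..d})"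
    if "c \<in> {a..b}" "d \<in> {a..b}" "c \<le> t" "t \<le> d" for c d t
    by (rule has_derivative_subset[of _ _ _ "{a..b}"])
      (use dG[of t] that in \<open>auto simp: has_field_derivative_def\<close>)
  have "\<forall>\<^sub>F t in at s within {a..b}. \<bar>g' t / (t - s) ^ m - \<rho>\<bar> < \<epsilon> / 2"
    using lim \<open>0 < \<epsilon>\<close> by (auto dest: tendstoD[of _ _ _ "\<epsilon> / 2"] simp: dist_real_def)
  then obtain d where d: "0 < d"
    "\<And>t. t \<in> {a..b} \<Longrightarrow> t \<noteq> s \<Longrightarrow> \<bar>t - s\<bar> < d \<Longrightarrow> \<bar>g' t / (t - s) ^ m - \<rho>\<bar> < \<epsilon> / 2"
    by (auto simp: eventually_at dist_real_def)
  have "\<bar>g t / (t - s) ^ Suc m - \<rho> / Suc m\<bar> < \<epsilon>" if t: "t \<in> {a..b}" "t \<noteq> s" "\<bar>t - s\<bar> < d" for t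
  proof -
    have "\<exists>\<xi>. \<bar>\<xi> - s\<bar> \<le> \<bar>t - s\<bar> \<and> \<xi> \<noteq> s \<and> \<xi> \<in> {a..b} \<and> G t - G s = (g' \<xi> - \<rho> * (\<xi> - s) ^ m) * (t - s)"
    proof (cases "s < t")
      case True
      have "\<exists>\<xi>\<in>{s<..<t}. G t - G s = (\<lambda>h. (g' \<xi> - \<rho> * (\<xi> - s) ^ m) * h) (t - s)"
        by (rule mvt_simple[OF True])
          (use dG_sub t s in auto)
      then show ?thesis using t s by force
    next
      case False
      then have "t < s" using t by simp
      then have "\<exists>\<xi>\<in>{t<..<s}. G s - G t = (\<lambda>h. (g' \<xi> - \<rho> * (\<xi> - s) ^ m) * h) (s - t)"
        by (rule mvt_simple)
          (use dG_sub t s in auto)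
      then obtain \<xi> where "\<xi> \<in> {t<..<s}" "G s - G t = (g' \<xi> - \<rho> * (\<xi> - s) ^ m) * (s - t)" by auto
      then show ?thesis using t s by (intro exI[of _ \<xi>]) (auto simp: algebra_simps)
    qed
    then obtain \<xi> where \<xi>: "\<bar>\<xi> - s\<bar> \<le> \<bar>t - s\<bar>" "\<xi> \<noteq> s" "\<xi> \<in> {a..b}"
      "G t - G s = (g' \<xi> - \<rho> * (\<xi> - s) ^ m) * (t - s)" by blast
    have "\<bar>G t\<bar> = \<bar>(g' \<xi> / (\<xi> - s) ^ m - \<rho>) * (\<xi> - s) ^ m * (t - s)\<bar>"
    proof -
      have "G s = 0" by (simp add: G_def s)
      moreover have "(g' \<xi> / (\<xi> - s) ^ m - \<rho>) * (\<xi> - s) ^ m = g' \<xi> - \<rho> * (\<xi> - s) ^ m"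
        using \<xi>(2) by (simp add: left_diff_distrib)
      ultimately show ?thesis using \<xi>(4) by simp
    qed
    also have "\<dots> = \<bar>g' \<xi> / (\<xi> - s) ^ m - \<rho>\<bar> * \<bar>\<xi> - s\<bar> ^ m * \<bar>t - s\<bar>"
      by (simp add: abs_mult power_abs)
    also have "\<dots> \<le> (\<epsilon> / 2) * \<bar>t - s\<bar> ^ m * \<bar>t - s\<bar>"
      using d(2)[OF \<xi>(3,2)] \<xi>(1) t(3) \<open>0 < \<epsilon>\<close>
      by (intro mult_right_mono mult_mono power_mono) auto
    finally have "\<bar>G t\<bar> \<le> \<epsilon> / 2 * \<bar>t - s\<bar> ^ Suc m" by (simp add: mult_ac)
    moreover have "g t / (t - s) ^ Suc m - \<rho> / Suc m = G t / (t - s) ^ Suc m"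
      using t(2) by (simp add: G_def diff_divide_distrib del: power_Suc)
    ultimately have "\<bar>g t / (t - s) ^ Suc m - \<rho> / Suc m\<bar> \<le> \<epsilon> / 2"
      using t(2) by (simp add: abs_divide power_abs pos_divide_le_eq del: power_Suc)
    then show ?thesis using \<open>0 < \<epsilon>\<close> by linarith
  qed
  then show "\<forall>\<^sub>F t in at s within {a..b}. dist (g t / (t - s) ^ Suc m) (\<rho> / Suc m) < \<epsilon>"
    using d(1) by (auto simp: eventually_at dist_real_def)
qed

text \<open>
  \<open>a\<close> and \<open>b\<close> are the components of the adjoint vector dual to \<open>q\<close> and \<open>p\<close>. The convention
  \<open>\<psi> 0 = \<psi> n = 0\<close> makes the junk values \<open>b 0\<close> and \<open>b (n + 1)\<close> irrelevant.
\<close>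

locale chain =
  fixes n :: nat and T :: real and a b \<psi> :: "nat \<Rightarrow> real \<Rightarrow> real"
  assumes deriv_b: "\<And>k t. k \<in> {1..n} \<Longrightarrow> t \<in> {0..T} \<Longrightarrow>
      (b k has_real_derivative - a k t) (at t within {0..T})"
    and deriv_a: "\<And>k t. k \<in> {1..n} \<Longrightarrow> t \<in> {0..T} \<Longrightarrow>
      (a k has_real_derivative \<psi> k t * (b k t - b (k + 1) t) - \<psi> (k - 1) t * (b (k - 1) t - b k t))
        (at t within {0..T})"
    and cont_\<psi>: "\<And>k. continuous_on {0..T} (\<psi> k)"
    and \<psi>_nonzero: "\<And>k t. k \<in> {1..<n} \<Longrightarrow> t \<in> {0..T} \<Longrightarrow> \<psi> k t \<noteq> 0"
    and \<psi>_end: "\<psi> 0 = (\<lambda>_. 0)" "\<psi> n = (\<lambda>_. 0)"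
    and nontrivial: "\<And>t. t \<in> {0..T} \<Longrightarrow> \<exists>k\<in>{1..n}. a k t \<noteq> 0 \<or> b k t \<noteq> 0"
begin

text \<open>
  If \<open>k\<close> is the first index at which \<open>(a, b)\<close> does not vanish at \<open>s\<close>, then \<open>b k\<close> has a zero of order
  \<open>m \<le> 1\<close> at \<open>s\<close> and each step down the chain raises the order by exactly two, because \<open>b j'' \<approx> \<psi> j * b (j + 1)\<close>
  there. The order of \<open>b 1\<close> is thus finite although \<open>b 1\<close> is only twice differentiable.
\<close>

lemma eventually_first_nonzero:
  assumes s: "s \<in> {0..T}"
  shows "\<forall>\<^sub>F t in at s within {0..T}. b 1 t \<noteq> 0"
proof -
  let ?F = "at s within {0..T}"
  define P where "P k \<longleftrightarrow> k \<in> {1..n} \<and> (a k s \<noteq> 0 \<or> b k s \<noteq> 0)" for k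
  define k where "k = (LEAST k. P k)"
  have "P k"
    unfolding k_def by (rule LeastI_ex) (use nontrivial[OF s] in \<open>auto simp: P_def\<close>)
  then have k: "k \<in> {1..n}" "a k s \<noteq> 0 \<or> b k s \<noteq> 0" by (auto simp: P_def)
  have zero: "a j s = 0" "b j s = 0" if "j \<in> {1..<k}" for j
  proof -
    have "\<not> P j" using that not_less_Least[of j P] by (simp add: k_def)
    then show "a j s = 0" "b j s = 0" using that k by (auto simp: P_def)
  qed
  have lim_b: "(b j \<longlongrightarrow> b j s) ?F" if "j \<in> {1..n}" for j
    using deriv_b[OF that s] has_field_derivative_imp_has_derivative has_derivative_continuous
    by (metis continuous_within has_field_derivative_def)
  have lim_b1: "((\<lambda>t. b j t / (t - s)) \<longlongrightarrow> - a j s) ?F" if "j \<in> {1..n}" "b j s = 0" for j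
    using deriv_b[OF that(1) s] that(2) by (simp add: has_field_derivative_iff)
  have lim_\<psi>: "(\<psi> j \<longlongrightarrow> \<psi> j s) ?F" for j
    using cont_\<psi>[of j] s by (simp add: continuous_on_def)
  define m :: nat where "m = (if b k s = 0 then 1 else 0)"
  \<comment> \<open>The induction runs over rounds \<open>d\<close> and not over particles: the
    equation at \<open>j\<close> involves both neighbours, and \<open>b (j - 1)\<close> must already
    be known to be negligible at order \<open>m + 2 * d\<close>. Round \<open>d\<close> settles the
    exact order for all \<open>j\<close> within distance \<open>d\<close> of \<open>k\<close> and
    gives the others vanishing beyond order \<open>m + 2 * d\<close>. In the next step only
    \<open>b (j + 1)\<close> can contribute a nonzero limit.\<close>
  have lims: "\<forall>j\<in>{1..k}. \<exists>c. ((\<lambda>t. b j t / (t - s) ^ (m + 2 * min (k - j) d)) \<longlongrightarrow> c) ?F \<and>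
      (c = 0 \<longleftrightarrow> d < k - j)" for d
  proof (induction d)
    case 0
    show ?case
    proof
      fix j assume j: "j \<in> {1..k}"
      show "\<exists>c. ((\<lambda>t. b j t / (t - s) ^ (m + 2 * min (k - j) 0)) \<longlongrightarrow> c) ?F \<and> (c = 0 \<longleftrightarrow> 0 < k - j)"
      proof (cases "b k s = 0")
        case True
        then show ?thesis
          using j k zero[of j] lim_b1[of j] by (intro exI[of _ "- a j s"]) (cases "j = k"; auto simp: m_def)
      next
        case False
        then show ?thesis
          using j k zero[of j] lim_b[of j] by (intro exI[of _ "b j s"]) (cases "j = k"; auto simp: m_def)
      qed
    qed
  next
    case (Suc d)
    show ?case
    proof
      fix j assume j: "j \<in> {1..k}"
      show "\<exists>c. ((\<lambda>t. b j t / (t - s) ^ (m + 2 * min (k - j) (Suc d))) \<longlongrightarrow> c) ?F \<and> (c = 0 \<longleftrightarrow> Suc d < k - j)"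
      proof (cases "k - j \<le> d")
        case True
        then have "min (k - j) d = min (k - j) (Suc d)" by simp
        with Suc.IH j True show ?thesis by (metis not_less le_SucI)
      next
        case False
        define e where "e = m + 2 * d"
        have jn: "j \<in> {1..n}" "j \<in> {1..<k}" "j \<in> {1..<n}" using False j k by auto
        have l0: "((\<lambda>t. b j t / (t - s) ^ e) \<longlongrightarrow> 0) ?F"
          using bspec[OF Suc.IH j] False by (auto simp: e_def min_def)
        have lp: "((\<lambda>t. \<psi> (j - 1) t * (b (j - 1) t / (t - s) ^ e)) \<longlongrightarrow> 0) ?F"
        proof (cases "j = 1")
          case True
          then show ?thesis by (simp add: \<psi>_end)
        next
          case j1: False
          have "((\<lambda>t. b (j - 1) t / (t - s) ^ e) \<longlongrightarrow> 0) ?F"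
          proof -
            have p: "j - 1 \<in> {1..k}" "min (k - (j - 1)) d = d" "d < k - (j - 1)" using False j j1 by auto
            show ?thesis using bspec[OF Suc.IH p(1)] p(3) unfolding p(2) e_def by blast
          qed
          from tendsto_mult[OF lim_\<psi> this] show ?thesis by simp
        qed
        have p: "j + 1 \<in> {1..k}" "min (k - (j + 1)) d = d" using jn False by auto
        obtain c where c: "((\<lambda>t. b (j + 1) t / (t - s) ^ e) \<longlongrightarrow> c) ?F" "c = 0 \<longleftrightarrow> d < k - (j + 1)"
          using bspec[OF Suc.IH p(1)] unfolding p(2) e_def by blast
        have "((\<lambda>t. \<psi> j t * (b j t / (t - s) ^ e - b (j + 1) t / (t - s) ^ e)
              - (\<psi> (j - 1) t * (b (j - 1) t / (t - s) ^ e) - \<psi> (j - 1) t * (b j t / (t - s) ^ e)))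
            \<longlongrightarrow> \<psi> j s * (0 - c) - (0 - \<psi> (j - 1) s * 0)) ?F"
          by (intro tendsto_intros lim_\<psi> l0 lp c(1))
        then have "((\<lambda>t. (\<psi> j t * (b j t - b (j + 1) t) - \<psi> (j - 1) t * (b (j - 1) t - b j t)) / (t - s) ^ e)
            \<longlongrightarrow> - (\<psi> j s * c)) ?F"
          by (simp add: right_diff_distrib diff_divide_distrib)
        from tendsto_power_quotient_integrate[OF deriv_a[OF jn(1)] s _ this]
        have "((\<lambda>t. a j t / (t - s) ^ Suc e) \<longlongrightarrow> - (\<psi> j s * c) / Suc e) ?F"
          using zero[OF jn(2)] by simp
        from tendsto_minus[OF this]
        have "((\<lambda>t. - a j t / (t - s) ^ Suc e) \<longlongrightarrow> \<psi> j s * c / Suc e) ?F"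
          by simp
        from tendsto_power_quotient_integrate[OF deriv_b[OF jn(1)] s _ this]
        have "((\<lambda>t. b j t / (t - s) ^ Suc (Suc e)) \<longlongrightarrow> \<psi> j s * c / Suc e / Suc (Suc e)) ?F"
          using zero[OF jn(2)] by simp
        moreover have "Suc (Suc e) = m + 2 * min (k - j) (Suc d)"
          using False by (simp add: e_def min_def)
        moreover have "\<psi> j s * c / Suc e / Suc (Suc e) = 0 \<longleftrightarrow> Suc d < k - j"
          using \<psi>_nonzero[OF jn(3) s] c(2) by auto
        ultimately show ?thesis by metis
      qed
    qed
  qed
  obtain c where c: "((\<lambda>t. b 1 t / (t - s) ^ (m + 2 * min (k - 1) k)) \<longlongrightarrow> c) ?F" "c \<noteq> 0"
    using bspec[OF lims, of 1 k] k by auto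
  then have "\<forall>\<^sub>F t in ?F. b 1 t / (t - s) ^ (m + 2 * min (k - 1) k) \<noteq> 0"
    by (rule tendsto_imp_eventually_ne)
  then show ?thesis
    by eventually_elim auto
qed

text \<open>Infinitely many zeros would accumulate at a point of the compact interval, where zeros
  are isolated.\<close>

lemma finite_zeros_first: "finite {t \<in> {0..T}. b 1 t = 0}"
proof (rule ccontr)
  assume "infinite {t \<in> {0..T}. b 1 t = 0}"
  moreover have "compact {0..T}" by simp
  ultimately obtain s where s: "s \<in> {0..T}" "s islimpt {t \<in> {0..T}. b 1 t = 0}"
    unfolding compact_eq_Bolzano_Weierstrass by (metis (no_types, lifting) mem_Collect_eq subsetI)
  have "\<forall>\<^sub>F t in at s. t \<notin> {t \<in> {0..T}. b 1 t = 0}"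
    using eventually_first_nonzero[OF s(1)] by (simp add: eventually_at_filter) (auto elim: eventually_mono)
  with s(2) show False by (simp add: islimpt_iff_eventually)
qed

end

text \<open>Reflection sends particle \<open>k\<close> to \<open>n + 1 - k\<close>, hence the bond
  between \<open>k\<close> and \<open>k + 1\<close> to bond \<open>n - k\<close>. It turns
  statements about the first particle into statements about the last.\<close>

lemma (in chain) chain_reverse:
  "chain n T (\<lambda>k. a (n + 1 - k)) (\<lambda>k. b (n + 1 - k)) (\<lambda>k. \<psi> (n - k))"
proof
  fix k t assume k: "k \<in> {1..n}" and t: "t \<in> {0..T}"
  then have k': "n + 1 - k \<in> {1..n}" by auto
  show "(b (n + 1 - k) has_real_derivative - a (n + 1 - k) t) (at t within {0..T})"
    by (rule deriv_b[OF k' t])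
  have "n + 1 - k - 1 = n - k" "n - (k - 1) = n + 1 - k" "n + 1 - (k + 1) = n - k" "n + 1 - (k - 1) = n + 1 - k + 1"
    using k by auto
  then show "(a (n + 1 - k) has_real_derivative
      \<psi> (n - k) t * (b (n + 1 - k) t - b (n + 1 - (k + 1)) t)
      - \<psi> (n - (k - 1)) t * (b (n + 1 - (k - 1)) t - b (n + 1 - k) t)) (at t within {0..T})"
    using deriv_a[OF k' t] by (simp add: algebra_simps)
next
  fix t assume "t \<in> {0..T}"
  from nontrivial[OF this] obtain k where "k \<in> {1..n}" "a k t \<noteq> 0 \<or> b k t \<noteq> 0" by blast
  then show "\<exists>k\<in>{1..n}. a (n + 1 - k) t \<noteq> 0 \<or> b (n + 1 - k) t \<noteq> 0"
    by (intro bexI[of _ "n + 1 - k"]) auto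
qed (use cont_\<psi> \<psi>_nonzero \<psi>_end in auto)

lemma (in chain) finite_zeros_last: "finite {t \<in> {0..T}. b n t = 0}"
  using chain.finite_zeros_first[OF chain_reverse] by simp

section \<open>Switchings of the particle chain\<close>

text \<open>Local power series may be differentiated term by term without loss of radius. Applied to
  \<Phi> and then to \<phi>, this makes the drift continuously differentiable.\<close>

lemma real_analytic_imp_deriv:
  assumes "real_analytic F"
  shows "(F has_real_derivative deriv F y) (at y)" "real_analytic (deriv F)"
proof -
  have *: "\<exists>r>0. \<exists>a. \<forall>y. \<bar>y - z\<bar> < r \<longrightarrow>
      (F has_real_derivative deriv F y) (at y) \<and> (\<lambda>k. a k * (y - z) ^ k) sums deriv F y" for z
  proof -
    obtain r a where r: "0 < r" "\<And>y. \<bar>y - z\<bar> < r \<Longrightarrow> (\<lambda>k. a k * (y - z) ^ k) sums F y"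
      using assms unfolding real_analytic_def by blast
    have sm: "summable (\<lambda>k. a k * h ^ k)" if "norm h < r" for h
      using r(2)[of "z + h"] that by (auto simp: sums_iff)
    have "(F has_real_derivative (\<Sum>k. diffs a k * (y - z) ^ k)) (at y)" if y: "\<bar>y - z\<bar> < r" for y
    proof -
      have "((\<lambda>h. \<Sum>k. a k * h ^ k) has_real_derivative (\<Sum>k. diffs a k * (y - z) ^ k)) (at (y - z))"
        by (rule termdiffs_strong'[of r], rule sm) (use y in auto)
      then have "((\<lambda>y. \<Sum>k. a k * (y - z) ^ k) has_real_derivative (\<Sum>k. diffs a k * (y - z) ^ k) * 1) (at y)"
        by (rule DERIV_chain2) (auto intro!: derivative_eq_intros)
      then have "((\<lambda>y. \<Sum>k. a k * (y - z) ^ k) has_real_derivative (\<Sum>k. diffs a k * (y - z) ^ k)) (at y)"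
        by simp
      then show ?thesis
        by (rule has_field_derivative_transform_within_open[of _ _ _ "ball z r"])
          (use y r(2) in \<open>auto simp: dist_real_def abs_minus_commute sums_iff\<close>)
    qed
    moreover have "summable (\<lambda>k. diffs a k * h ^ k)" if "norm h < r" for h
      using termdiff_converges[OF that sm] by simp
    ultimately have "(F has_real_derivative deriv F y) (at y) \<and> (\<lambda>k. diffs a k * (y - z) ^ k) sums deriv F y"
      if "\<bar>y - z\<bar> < r" for y
      using that DERIV_imp_deriv by (fastforce simp: sums_iff)
    with r(1) show ?thesis by blast
  qed
  show "(F has_real_derivative deriv F y) (at y)"
    using *[of y] by auto
  show "real_analytic (deriv F)"
    unfolding real_analytic_def using * by blast
qed

lemma real_analytic_imp_continuous: "real_analytic F \<Longrightarrow> continuous_on S F"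
  using real_analytic_imp_deriv(1) by (meson DERIV_continuous_on has_field_derivative_at_within)

lemma finite_set_partition:
  fixes T :: real
  assumes "finite Z" "Z \<subseteq> {0..T}" "0 < T"
  obtains N :: nat and \<tau> where "\<tau> 0 = 0" "\<tau> N = T" "\<And>i. i < N \<Longrightarrow> \<tau> i < \<tau> (Suc i)"
    "\<And>i. i < N \<Longrightarrow> {\<tau> i..\<tau> (Suc i)} \<subseteq> {0..T}" "\<And>i. i < N \<Longrightarrow> {\<tau> i<..<\<tau> (Suc i)} \<inter> Z = {}"
proof -
  define Y where "Y = Z \<union> {0, T}"
  have Y: "finite Y" "Y \<subseteq> {0..T}" "0 \<in> Y" "T \<in> Y" using assms by (auto simp: Y_def)
  define l where "l = sorted_list_of_set Y"
  have l: "set l = Y" "sorted_wrt (<) l"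
    using Y(1) by (auto simp: l_def)
  define N where "N = length l - 1"
  have len: "length l = Suc N" using l(1) Y(3) by (cases l) (auto simp: N_def)
  have mono: "l ! i < l ! j" if "i < j" "j \<le> N" for i j
    using l(2) that len by (simp add: sorted_wrt_iff_nth_less)
  have inY: "l ! i \<in> Y" if "i \<le> N" for i using that len l(1) nth_mem[of i l] by simp
  have idx: "\<exists>i\<le>N. y = l ! i" if "y \<in> Y" for y
    using that l(1) len by (metis in_set_conv_nth less_Suc_eq_le)
  show ?thesis
  proof
    obtain i where i: "i \<le> N" "0 = l ! i" using idx[OF Y(3)] by blast
    show "l ! 0 = 0"
      using mono[of 0 i] i inY[of 0] Y(2) by (cases "i = 0") auto
    obtain j where j: "j \<le> N" "T = l ! j" using idx[OF Y(4)] by blast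
    show "l ! N = T"
      using mono[of j N] j inY[of N] Y(2) by (cases "j = N") auto
    fix i assume i: "i < N"
    show "l ! i < l ! Suc i" using i by (intro mono) auto
    show "{l ! i..l ! Suc i} \<subseteq> {0..T}"
      using inY[of i] inY[of "Suc i"] i Y(2) by auto
    show "{l ! i<..<l ! Suc i} \<inter> Z = {}"
    proof (rule ccontr)
      assume "{l ! i<..<l ! Suc i} \<inter> Z \<noteq> {}"
      then obtain y where "l ! i < y" "y < l ! Suc i" "y \<in> Z" by auto
      then have y: "l ! i < y" "y < l ! Suc i" "y \<in> Y" by (auto simp: Y_def)
      obtain k where k: "k \<le> N" "y = l ! k" using idx[OF y(3)] by blast
      show False
        using mono[of k i] mono[of "Suc i" k] y k i by (cases i k rule: linorder_cases; cases "Suc i = k") auto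
    qed
  qed
qed

lemma nonzero_continuous_same_sign:
  fixes g :: "real \<Rightarrow> real"
  assumes "continuous_on S g" "connected S" "\<And>t. t \<in> S \<Longrightarrow> g t \<noteq> 0" "s \<in> S" "t \<in> S"
  shows "0 \<le> g s \<longleftrightarrow> 0 \<le> g t"
proof (rule ccontr)
  have c: "connected (g ` S)" using assms by (intro connected_continuous_image)
  assume "\<not> ?thesis"
  then have "0 \<in> g ` S"
    using connectedD_interval[OF c, of "g s" "g t" 0] connectedD_interval[OF c, of "g t" "g s" 0] assms(4,5)
    by force
  with assms(3) show False by auto
qed

text \<open>Nonnegativity upgrades gauge integrability to Lebesgue integrability, after which a
  vanishing integral forces vanishing almost everywhere.\<close>

lemma nonneg_integral_le_0_imp_AE:
  fixes g :: "real \<Rightarrow> real"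
  assumes "g integrable_on {a..b}" "\<And>t. t \<in> {a..b} \<Longrightarrow> 0 \<le> g t" "integral {a..b} g \<le> 0"
  shows "AE t in lebesgue_on {a..b}. g t = 0"
proof -
  have i: "integrable (lebesgue_on {a..b}) g"
    by (intro absolutely_integrable_imp_integrable nonnegative_absolutely_integrable_1 assms) auto
  have "integral\<^sup>L (lebesgue_on {a..b}) g = 0"
    using lebesgue_integral_eq_integral[OF i] integral_nonneg[OF assms(1,2)] assms(3) by simp
  moreover have "AE t in lebesgue_on {a..b}. 0 \<le> g t"
    by (rule AE_I2) (use assms in auto)
  ultimately show ?thesis
    using integral_nonneg_eq_0_iff_AE[OF i] by blast
qed

lemma AE_lebesgue_on_not_in_finite:
  fixes Z :: "real set"
  assumes "finite Z" "S \<in> sets lebesgue"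
  shows "AE t in lebesgue_on S. t \<notin> Z"
proof -
  have "Z \<in> null_sets lebesgue"
    using assms negligible_iff_null_sets by blast
  from AE_not_in[OF this] show ?thesis
    using assms(2) by (simp add: AE_restrict_space_iff) (auto elim: eventually_mono)
qed

lemma AE_lebesgue_on_subset:
  assumes "AE t in lebesgue_on S. P t" "R \<subseteq> S" "R \<in> sets lebesgue" "S \<in> sets lebesgue"
  shows "AE t in lebesgue_on R. P t"
  using assms by (auto simp: AE_restrict_space_iff elim: eventually_mono)

text \<open>
  Each bond acts with opposite forces \<open>\<plusminus> c k\<close> on its two ends. As this expression is linear in the
  momenta and in \<open>c\<close>, the derivative of the drift is again of this form.
\<close>

definition lattice_drift :: "nat \<Rightarrow> (nat \<Rightarrow> 'n::finite) \<Rightarrow> (nat \<Rightarrow> real) \<Rightarrow> 'n state \<Rightarrow> 'n state" where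
  "lattice_drift n \<iota> c y = (\<Sum>k=1..n. (snd y $ \<iota> k) *\<^sub>R dq \<iota> k) - (\<Sum>k=1..<n. c k *\<^sub>R (dp \<iota> k - dp \<iota> (k + 1)))"

text \<open>Regroups the forces by bonds instead of by particles; shifting the index of the second
  half of each bond recovers the interior sum, which is empty for \<open>n = 2\<close>.\<close>

lemma drift_eq_lattice_drift:
  assumes "2 \<le> n"
  shows "drift n \<iota> \<phi> y = lattice_drift n \<iota> (\<lambda>k. \<phi> (fst y $ \<iota> k - fst y $ \<iota> (k + 1))) y"
proof -
  define c where "c k = \<phi> (fst y $ \<iota> k - fst y $ \<iota> (k + 1))" for k
  have sets: "{1..<n} = insert 1 {2..n-1}" "{2..<Suc n} = insert n {2..n-1}"
    using assms by auto
  have "(\<Sum>k=1..<n. c k *\<^sub>R dp \<iota> (k + 1)) = (\<Sum>k=2..<Suc n. c (k - 1) *\<^sub>R dp \<iota> k)"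
    using sum.shift_bounds_Suc_ivl[of "\<lambda>k. c (k - 1) *\<^sub>R dp \<iota> k" 1 n] by (simp add: numeral_2_eq_2)
  also have "\<dots> = c (n - 1) *\<^sub>R dp \<iota> n + (\<Sum>k=2..n-1. c (k - 1) *\<^sub>R dp \<iota> k)"
    unfolding sets using assms by (subst sum.insert) auto
  finally have 1: "(\<Sum>k=1..<n. c k *\<^sub>R dp \<iota> (k + 1)) = \<dots>" .
  have 2: "(\<Sum>k=1..<n. c k *\<^sub>R dp \<iota> k) = c 1 *\<^sub>R dp \<iota> 1 + (\<Sum>k=2..n-1. c k *\<^sub>R dp \<iota> k)"
    unfolding sets by (subst sum.insert) auto
  have 3: "(\<Sum>k=2..n-1. (\<phi> (fst y $ \<iota> (k - 1) - fst y $ \<iota> k) - \<phi> (fst y $ \<iota> k - fst y $ \<iota> (k + 1))) *\<^sub>R dp \<iota> k)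
      = (\<Sum>k=2..n-1. c (k - 1) *\<^sub>R dp \<iota> k) - (\<Sum>k=2..n-1. c k *\<^sub>R dp \<iota> k)"
    unfolding sum_subtractf[symmetric] by (intro sum.cong) (auto simp: c_def scaleR_diff_left)
  have 4: "\<phi> (fst y $ \<iota> 1 - fst y $ \<iota> 2) = c 1" "\<phi> (fst y $ \<iota> (n - 1) - fst y $ \<iota> n) = c (n - 1)"
    using assms by (simp_all add: c_def numeral_2_eq_2)
  have "(\<Sum>k=1..<n. c k *\<^sub>R (dp \<iota> k - dp \<iota> (k + 1))) = (\<Sum>k=1..<n. c k *\<^sub>R dp \<iota> k) - (\<Sum>k=1..<n. c k *\<^sub>R dp \<iota> (k + 1))"
    by (simp only: scaleR_diff_right sum_subtractf)
  then show ?thesis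
    unfolding drift_def lattice_drift_def Let_def unfolding 3 4 unfolding c_def[symmetric] 1 2 by simp
qed

lemma inner_dq: "y \<bullet> dq \<iota> k = fst y $ \<iota> k" and inner_dp: "y \<bullet> dp \<iota> k = snd y $ \<iota> k"
  by (cases y; simp add: dq_def dp_def inner_axis)+

definition drift_deriv :: "nat \<Rightarrow> (nat \<Rightarrow> 'n::finite) \<Rightarrow> (real \<Rightarrow> real) \<Rightarrow> 'n state \<Rightarrow> 'n state \<Rightarrow> 'n state" where
  "drift_deriv n \<iota> \<phi>' y v = lattice_drift n \<iota>
     (\<lambda>k. (fst v $ \<iota> k - fst v $ \<iota> (k + 1)) * \<phi>' (fst y $ \<iota> k - fst y $ \<iota> (k + 1))) v"

lemma c1_field_drift:
  fixes \<iota> :: "nat \<Rightarrow> 'n::finite"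
  assumes n: "2 \<le> n" and \<phi>: "\<And>r. (\<phi> has_real_derivative \<phi>' r) (at r)" and \<phi>': "continuous_on UNIV \<phi>'"
  shows "c1_field (drift n \<iota> \<phi>) (drift_deriv n \<iota> \<phi>')"
proof
  fix y v :: "'n state"
  have lin: "((\<lambda>y. fst y $ i) has_derivative (\<lambda>v. fst v $ i)) (at y)"
    "((\<lambda>y. snd y $ i) has_derivative (\<lambda>v. snd v $ i)) (at y)" for i and y :: "'n state"
    by (intro bounded_linear_imp_has_derivative bounded_linear_compose[OF bounded_linear_vec_nth]
        bounded_linear_fst bounded_linear_snd)+
  have c: "((\<lambda>y. \<phi> (fst y $ i - fst y $ j)) has_derivative
      (\<lambda>v. (fst v $ i - fst v $ j) * \<phi>' (fst y $ i - fst y $ j))) (at y)" for i j and y :: "'n state"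
    by (rule DERIV_compose_FDERIV[OF \<phi>]) (intro has_derivative_diff lin)
  show "(drift n \<iota> \<phi> has_derivative drift_deriv n \<iota> \<phi>' y) (at y)"
    unfolding drift_eq_lattice_drift[OF n, abs_def] drift_deriv_def[abs_def] lattice_drift_def
    by (intro has_derivative_diff has_derivative_sum has_derivative_scaleR_left lin c)
  show "continuous_on UNIV (\<lambda>y. drift_deriv n \<iota> \<phi>' y v)"
    unfolding drift_deriv_def lattice_drift_def
    by (intro continuous_intros continuous_on_compose2[OF \<phi>']) auto
qed

section \<open>The particle chain as an additive control system\<close>

locale labelled =
  fixes n :: nat and \<iota> :: "nat \<Rightarrow> 'n::finite"
  assumes n: "2 \<le> n" and labelling: "labelling n \<iota>"
begin

lemma label_eq_iff: "j \<in> {1..n} \<Longrightarrow> k \<in> {1..n} \<Longrightarrow> \<iota> j = \<iota> k \<longleftrightarrow> j = k"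
  using labelling inj_on_eq_iff[of \<iota> "{1..n}" j k] by (simp add: labelling_def bij_betw_def)

lemma label_surj: "\<exists>k\<in>{1..n}. i = \<iota> k"
proof -
  have "i \<in> \<iota> ` {1..n}" using labelling by (simp add: labelling_def bij_betw_def)
  then show ?thesis by blast
qed

lemma dp_nth: "j \<in> {1..n} \<Longrightarrow> k \<in> {1..n} \<Longrightarrow> snd (dp \<iota> j) $ \<iota> k = (if j = k then 1 else 0)"
  "fst (dp \<iota> j) $ i = 0"
  by (auto simp: dp_def axis_def label_eq_iff)

lemma dq_nth: "j \<in> {1..n} \<Longrightarrow> k \<in> {1..n} \<Longrightarrow> fst (dq \<iota> j) $ \<iota> k = (if j = k then 1 else 0)"
  "snd (dq \<iota> j) $ i = 0"
  by (auto simp: dq_def axis_def label_eq_iff)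

lemma drift_deriv_dp:
  assumes "k \<in> {1..n}"
  shows "drift_deriv n \<iota> \<phi>' y (dp \<iota> k) = dq \<iota> k"
proof -
  have "(\<Sum>j=1..n. (snd (dp \<iota> k) $ \<iota> j) *\<^sub>R dq \<iota> j) = (\<Sum>j=1..n. if k = j then dq \<iota> j else 0)"
    using assms by (intro sum.cong) (auto simp: dp_nth)
  then show ?thesis
    using assms by (simp add: drift_deriv_def lattice_drift_def dp_nth(2))
qed

text \<open>Displacing one particle strains only the two bonds next to it, with opposite signs.
  Paired with the adjoint vector this yields the force term of the chain equations.\<close>

lemma inner_drift_deriv_dq:
  assumes k: "k \<in> {1..n}"
    and \<psi>: "\<And>j. \<psi> j = (if j \<in> {1..<n} then \<phi>' (fst y $ \<iota> j - fst y $ \<iota> (j + 1)) else 0)"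
    and b: "\<And>j. b j = snd \<mu> $ \<iota> j"
  shows "\<mu> \<bullet> drift_deriv n \<iota> \<phi>' y (dq \<iota> k) = \<psi> (k - 1) * (b (k - 1) - b k) - \<psi> k * (b k - b (k + 1))"
proof -
  have "\<mu> \<bullet> drift_deriv n \<iota> \<phi>' y (dq \<iota> k) =
      - (\<Sum>j=1..<n. (fst (dq \<iota> k) $ \<iota> j - fst (dq \<iota> k) $ \<iota> (j + 1)) * \<psi> j * (b j - b (j + 1)))"
    by (simp add: drift_deriv_def lattice_drift_def dq_nth(2) inner_sum_right inner_diff_right inner_dp b \<psi>
        del: sum.reindex)
  \<comment> \<open>For \<open>k = 1\<close> the truncated index \<open>k - 1\<close> is 0, outside
    the summation range, which matches \<open>\<psi> 0 = 0\<close>.\<close>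
  also have "\<dots> = - (\<Sum>j=1..<n. (if j = k then \<psi> j * (b j - b (j + 1)) else 0) - (if j = k - 1 then \<psi> j * (b j - b (j + 1)) else 0))"
    using k by (intro arg_cong[of _ _ uminus] sum.cong) (auto simp: dq_nth(1))
  also have "\<dots> = \<psi> (k - 1) * (b (k - 1) - b k) - \<psi> k * (b k - b (k + 1))"
    using k by (simp add: sum_subtractf \<psi>)
  finally show ?thesis .
qed

lemma ends: "1 \<in> {1..n}" "n \<in> {1..n}" "1 \<noteq> n"
  using n by auto

text \<open>The control rectangle embedded in the state space, as the abstract maximum principle
  expects.\<close>

definition control_set :: "real \<Rightarrow> 'n state set" where
  "control_set \<omega> = (\<lambda>(r, s). r *\<^sub>R dp \<iota> 1 + s *\<^sub>R dp \<iota> n) ` ({-\<omega>..\<omega>} \<times> {-\<omega>..0})"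

lemma convex_control_set: "convex (control_set \<omega>)"
  unfolding control_set_def
  by (intro convex_linear_image linearI convex_Times) (auto simp: algebra_simps)

lemma bounded_control_set: "bounded (control_set \<omega>)"
  unfolding control_set_def split_beta
  by (intro compact_imp_bounded compact_continuous_image compact_Times continuous_intros) auto

lemma control_of_admissible:
  assumes "admissible_control \<omega> T u v"
  shows "control (control_set \<omega>) T (\<lambda>t. u t *\<^sub>R dp \<iota> 1 + v t *\<^sub>R dp \<iota> n)"
  unfolding control_def
proof safe
  show "(\<lambda>t. u t *\<^sub>R dp \<iota> 1 + v t *\<^sub>R dp \<iota> n) \<in> borel_measurable (lebesgue_on {0..T})"
    using assms by (intro borel_measurable_add borel_measurable_scaleR borel_measurable_const)
      (auto simp: admissible_control_def)
  fix t assume "t \<in> {0..T}"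
  then have "(u t, v t) \<in> {-\<omega>..\<omega>} \<times> {-\<omega>..0}"
    using assms unfolding admissible_control_def by blast
  then show "u t *\<^sub>R dp \<iota> 1 + v t *\<^sub>R dp \<iota> n \<in> control_set \<omega>"
    unfolding control_set_def by (rule rev_image_eqI) simp
qed

text \<open>The two control directions are orthonormal because \<open>1 \<noteq> n\<close>, so inner
  products recover the scalar controls and preserve measurability.\<close>

lemma admissible_of_control:
  assumes "control (control_set \<omega>) T h"
  obtains u v where "admissible_control \<omega> T u v" "\<And>t. t \<in> {0..T} \<Longrightarrow> h t = u t *\<^sub>R dp \<iota> 1 + v t *\<^sub>R dp \<iota> n"
proof -
  define u where "u t = h t \<bullet> dp \<iota> 1" for t
  define v where "v t = h t \<bullet> dp \<iota> n" for t
  have uv: "u t \<in> {-\<omega>..\<omega>}" "v t \<in> {-\<omega>..0}" "h t = u t *\<^sub>R dp \<iota> 1 + v t *\<^sub>R dp \<iota> n"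
    if t: "t \<in> {0..T}" for t
  proof -
    have "h t \<in> control_set \<omega>" using assms t by (simp add: control_def)
    then obtain r s where rs: "r \<in> {-\<omega>..\<omega>}" "s \<in> {-\<omega>..0}" "h t = r *\<^sub>R dp \<iota> 1 + s *\<^sub>R dp \<iota> n"
      by (auto simp: control_set_def)
    have "u t = r" "v t = s"
      using dp_nth(1)[OF ends(1,1)] dp_nth(1)[OF ends(1,2)] dp_nth(1)[OF ends(2,1)] dp_nth(1)[OF ends(2,2)] ends(3)
      by (simp_all add: u_def v_def rs(3) inner_dp)
    with rs show "u t \<in> {-\<omega>..\<omega>}" "v t \<in> {-\<omega>..0}" "h t = u t *\<^sub>R dp \<iota> 1 + v t *\<^sub>R dp \<iota> n" by simp_all
  qed
  have h: "h \<in> borel_measurable (lebesgue_on {0..T})" using assms by (simp add: control_def)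
  have "u \<in> borel_measurable (lebesgue_on {0..T})" "v \<in> borel_measurable (lebesgue_on {0..T})"
    unfolding u_def[abs_def] v_def[abs_def] by (intro borel_measurable_inner borel_measurable_const h)+
  with uv have "admissible_control \<omega> T u v" unfolding admissible_control_def by blast
  then show ?thesis by (rule that) (rule uv(3))
qed

lemma trajectory_iff:
  "trajectory n \<iota> \<phi> T u v x \<longleftrightarrow>
    controlled_solution (drift n \<iota> \<phi>) T (\<lambda>t. u t *\<^sub>R dp \<iota> 1 + v t *\<^sub>R dp \<iota> n) x"
  by (simp add: trajectory_def controlled_solution_def g_u_def g_v_def add.assoc)

lemma controlled_solution_imp_steers:
  assumes "0 < T" "control (control_set \<omega>) T h" "controlled_solution (drift n \<iota> \<phi>) T h x"
  shows "\<exists>u v. steers n \<iota> \<phi> \<omega> (x 0) (x T) T u v"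
proof -
  obtain u v where uv: "admissible_control \<omega> T u v"
    "\<And>t. t \<in> {0..T} \<Longrightarrow> h t = u t *\<^sub>R dp \<iota> 1 + v t *\<^sub>R dp \<iota> n"
    using admissible_of_control[OF assms(2)] by metis
  have "controlled_solution (drift n \<iota> \<phi>) T (\<lambda>t. u t *\<^sub>R dp \<iota> 1 + v t *\<^sub>R dp \<iota> n) x"
    unfolding controlled_solution_def
  proof
    fix t assume t: "t \<in> {0..T}"
    then have "((\<lambda>s. drift n \<iota> \<phi> (x s) + h s) has_integral (x t - x 0)) {0..t}"
      using assms(3) by (simp add: controlled_solution_def)
    then show "((\<lambda>s. drift n \<iota> \<phi> (x s) + (u s *\<^sub>R dp \<iota> 1 + v s *\<^sub>R dp \<iota> n)) has_integral (x t - x 0)) {0..t}"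
      by (rule has_integral_eq[rotated]) (use uv(2) t in auto)
  qed
  then show ?thesis
    using assms(1) uv(1) unfolding steers_def trajectory_iff by blast
qed

text \<open>The adjoint equation is tested against \<open>dp \<iota> k\<close> and
  \<open>dq \<iota> k\<close>; the first gives \<open>b k' = - a k\<close> since the linearised
  drift maps \<open>dp \<iota> k\<close> to \<open>dq \<iota> k\<close>. Setting the bond
  coefficients to 0 outside \<open>{1..<n}\<close> provides the free ends.\<close>

lemma chain_of_adjoint:
  fixes \<mu> x :: "real \<Rightarrow> 'n state"
  assumes field: "c1_field (drift n \<iota> \<phi>) (drift_deriv n \<iota> \<phi>')"
    and \<phi>': "continuous_on UNIV \<phi>'" "\<And>r. \<phi>' r \<noteq> 0" and x: "continuous_on {0..T} x"
    and nonzero: "\<And>t. t \<in> {0..T} \<Longrightarrow> \<mu> t \<noteq> 0"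
    and \<mu>: "\<And>t. t \<in> {0..T} \<Longrightarrow>
      (\<mu> has_vector_derivative - adjoint (drift_deriv n \<iota> \<phi>' (x t)) (\<mu> t)) (at t within {0..T})"
  shows "chain n T (\<lambda>k t. fst (\<mu> t) $ \<iota> k) (\<lambda>k t. snd (\<mu> t) $ \<iota> k)
    (\<lambda>k t. if k \<in> {1..<n} then \<phi>' (fst (x t) $ \<iota> k - fst (x t) $ \<iota> (k + 1)) else 0)"
proof
  have der: "((\<lambda>t. \<mu> t \<bullet> e) has_real_derivative - (\<mu> t \<bullet> drift_deriv n \<iota> \<phi>' (x t) e)) (at t within {0..T})"
    if t: "t \<in> {0..T}" for t e
  proof -
    have "((\<lambda>t. \<mu> t \<bullet> e) has_vector_derivative - adjoint (drift_deriv n \<iota> \<phi>' (x t)) (\<mu> t) \<bullet> e) (at t within {0..T})"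
      by (rule bounded_linear.has_vector_derivative[OF bounded_linear_inner_left \<mu>[OF t]])
    then show ?thesis
      using adjoint_works[OF c1_field.linear_derivative[OF field], of e "x t" "\<mu> t"]
      by (simp add: has_real_derivative_iff_has_vector_derivative inner_commute)
  qed
  fix k t assume k: "k \<in> {1..n}" and t: "t \<in> {0..T}"
  show "((\<lambda>t. snd (\<mu> t) $ \<iota> k) has_real_derivative - fst (\<mu> t) $ \<iota> k) (at t within {0..T})"
    using der[OF t, of "dp \<iota> k"] by (simp add: drift_deriv_dp[OF k] inner_dp inner_dq)
  show "((\<lambda>t. fst (\<mu> t) $ \<iota> k) has_real_derivative
      (if k \<in> {1..<n} then \<phi>' (fst (x t) $ \<iota> k - fst (x t) $ \<iota> (k + 1)) else 0) *
        (snd (\<mu> t) $ \<iota> k - snd (\<mu> t) $ \<iota> (k + 1))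
      - (if k - 1 \<in> {1..<n} then \<phi>' (fst (x t) $ \<iota> (k - 1) - fst (x t) $ \<iota> (k - 1 + 1)) else 0) *
        (snd (\<mu> t) $ \<iota> (k - 1) - snd (\<mu> t) $ \<iota> k)) (at t within {0..T})"
    using der[OF t, of "dq \<iota> k"]
      inner_drift_deriv_dq[OF k refl refl, where \<mu> = "\<mu> t" and y = "x t" and \<phi>' = \<phi>']
    by (simp only: inner_dq minus_diff_eq)
next
  fix k :: nat
  show "continuous_on {0..T} (\<lambda>t. if k \<in> {1..<n} then \<phi>' (fst (x t) $ \<iota> k - fst (x t) $ \<iota> (k + 1)) else 0)"
  proof (cases "k \<in> {1..<n}")
    case True
    have "continuous_on {0..T} (\<lambda>t. \<phi>' (fst (x t) $ \<iota> k - fst (x t) $ \<iota> (k + 1)))"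
      by (intro continuous_on_compose2[OF \<phi>'(1)] continuous_intros x) auto
    with True show ?thesis by simp
  next
    case False
    then show ?thesis by (simp only: if_False continuous_on_const)
  qed
next
  fix t assume t: "t \<in> {0..T}"
  show "\<exists>k\<in>{1..n}. fst (\<mu> t) $ \<iota> k \<noteq> 0 \<or> snd (\<mu> t) $ \<iota> k \<noteq> 0"
  proof (rule ccontr)
    assume "\<not> ?thesis"
    then have "fst (\<mu> t) $ i = 0 \<and> snd (\<mu> t) $ i = 0" for i
      using label_surj[of i] by auto
    then have "\<mu> t = 0" by (simp add: prod_eq_iff vec_eq_iff)
    with nonzero[OF t] show False by blast
  qed
qed (use \<phi>'(2) in auto)

end

text \<open>Between consecutive zeros of \<open>g\<close> and \<open>h\<close> both signs are
  constant, so any function \<open>F\<close> of the sign pattern is constant there.\<close>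

lemma sign_control_switchings:
  fixes g h :: "real \<Rightarrow> real"
  assumes T: "0 < T" and c: "continuous_on {0..T} g" "continuous_on {0..T} h"
    and fin: "finite {t \<in> {0..T}. g t = 0}" "finite {t \<in> {0..T}. h t = 0}"
    and uv: "AE t in lebesgue_on {0..T}. (u t, v t) = F (0 \<le> g t) (0 \<le> h t)"
  shows "finitely_many_switchings T u v"
proof -
  define Z where "Z = {t \<in> {0..T}. g t = 0} \<union> {t \<in> {0..T}. h t = 0}"
  have "finite Z" "Z \<subseteq> {0..T}" using fin by (auto simp: Z_def)
  from finite_set_partition[OF this T] obtain N :: nat and \<tau> where \<tau>: "\<tau> 0 = 0" "\<tau> N = T"
    "\<And>i. i < N \<Longrightarrow> \<tau> i < \<tau> (Suc i)" "\<And>i. i < N \<Longrightarrow> {\<tau> i..\<tau> (Suc i)} \<subseteq> {0..T}"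
    "\<And>i. i < N \<Longrightarrow> {\<tau> i<..<\<tau> (Suc i)} \<inter> Z = {}"
    by metis
  \<comment> \<open>The midpoint represents its piece, since it avoids the endpoints, where
    \<open>g\<close> or \<open>h\<close> may vanish.\<close>
  define w where "w i = (let s = (\<tau> i + \<tau> (Suc i)) / 2 in F (0 \<le> g s) (0 \<le> h s))" for i
  have "AE t in lebesgue_on {\<tau> i..\<tau> (Suc i)}. (u t, v t) = w i" if i: "i < N" for i
  proof -
    let ?I = "{\<tau> i<..<\<tau> (Suc i)}" and ?s = "(\<tau> i + \<tau> (Suc i)) / 2"
    have sub: "?I \<subseteq> {0..T}" using \<tau>(4)[OF i] by auto
    have nz: "g r \<noteq> 0" "h r \<noteq> 0" if "r \<in> ?I" for r
      using that \<tau>(5)[OF i] subsetD[OF sub that] unfolding Z_def by blast+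
    have "AE t in lebesgue_on {\<tau> i..\<tau> (Suc i)}. (u t, v t) = F (0 \<le> g t) (0 \<le> h t)"
      by (rule AE_lebesgue_on_subset[OF uv \<tau>(4)[OF i]]) auto
    moreover have "AE t in lebesgue_on {\<tau> i..\<tau> (Suc i)}. t \<notin> {\<tau> i, \<tau> (Suc i)}"
      by (rule AE_lebesgue_on_not_in_finite) auto
    moreover have "AE t in lebesgue_on {\<tau> i..\<tau> (Suc i)}. t \<in> {\<tau> i..\<tau> (Suc i)}"
      by (rule AE_I2) simp
    ultimately show ?thesis
    proof eventually_elim
      case (elim t)
      then have t: "t \<in> ?I" by auto
      have s: "?s \<in> ?I" using \<tau>(3)[OF i] by simp
      have "0 \<le> g t \<longleftrightarrow> 0 \<le> g ?s"
        by (rule nonzero_continuous_same_sign[OF continuous_on_subset[OF c(1) sub] connected_Ioo _ t s]) (rule nz(1))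
      moreover have "0 \<le> h t \<longleftrightarrow> 0 \<le> h ?s"
        by (rule nonzero_continuous_same_sign[OF continuous_on_subset[OF c(2) sub] connected_Ioo _ t s]) (rule nz(2))
      ultimately show ?case using elim(1) by (simp add: w_def Let_def)
    qed
  qed
  with \<tau>(1-3) show ?thesis unfolding finitely_many_switchings_def by blast
qed

theorem theorem5p1:
  fixes n :: nat
    and \<iota> :: "nat \<Rightarrow> 'n::finite"
    and \<Phi> \<phi> :: "real \<Rightarrow> real"
    and \<omega> T :: real
    and x_init x_final :: "'n state"
    and u v :: "real \<Rightarrow> real"
  assumes "n \<ge> 2"
    and "labelling n \<iota>"
    and "real_analytic \<Phi>"
    and "bdd_below (range \<Phi>)"
    and "filterlim \<Phi> at_top at_top"
    and "\<phi> = deriv \<Phi>"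
    and "\<forall>y. deriv \<phi> y \<noteq> 0"
    and "\<omega> > 0"
    and "time_optimal n \<iota> \<phi> \<omega> x_init x_final T u v"
  shows "bang_bang \<omega> T u v \<and> finitely_many_switchings T u v"
proof -
  interpret labelled n \<iota> by standard (rule assms)+
  have an: "real_analytic \<phi>" using assms real_analytic_imp_deriv(2) by blast
  have \<phi>': "continuous_on UNIV (deriv \<phi>)"
    by (intro real_analytic_imp_continuous real_analytic_imp_deriv(2) an)
  have field: "c1_field (drift n \<iota> \<phi>) (drift_deriv n \<iota> (deriv \<phi>))"
    by (rule c1_field_drift[OF assms(1) real_analytic_imp_deriv(1)[OF an] \<phi>'])
  define h where "h t = u t *\<^sub>R dp \<iota> 1 + v t *\<^sub>R dp \<iota> n" for t
  obtain x where T: "0 < T" and adm: "admissible_control \<omega> T u v"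
    and x: "controlled_solution (drift n \<iota> \<phi>) T h x" "x 0 = x_init" "x T = x_final"
    using assms(9) unfolding time_optimal_def steers_def trajectory_iff h_def[abs_def] by blast
  have h: "control (control_set \<omega>) T h"
    unfolding h_def[abs_def] by (rule control_of_admissible[OF adm])
  have minimal: "T \<le> T'" if "0 < T'" "control (control_set \<omega>) T' w" "controlled_solution (drift n \<iota> \<phi>) T' w X"
    "X 0 = x 0" "X T' = x T" for T' w X
    using controlled_solution_imp_steers[OF that(1-3)] that(4,5) x assms(9)
    unfolding time_optimal_def by metis
  obtain \<mu> where \<mu>: "\<And>t. t \<in> {0..T} \<Longrightarrow> \<mu> t \<noteq> 0"
    "\<And>t. t \<in> {0..T} \<Longrightarrow>
      (\<mu> has_vector_derivative - adjoint (drift_deriv n \<iota> (deriv \<phi>) (x t)) (\<mu> t)) (at t within {0..T})"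
    and max: "\<And>w. control (control_set \<omega>) T w \<Longrightarrow> integral {0..T} (\<lambda>t. \<mu> t \<bullet> (w t - h t)) \<le> 0"
    by (rule c1_field.maximum_principle[OF field convex_control_set bounded_control_set T h x(1)],
        rule minimal, assumption+, rule that)
  have xc: "continuous_on {0..T} x"
    using x(1) T by (intro controlled_solution_continuous) auto
  have \<mu>c: "continuous_on {0..T} \<mu>"
    by (rule continuous_on_vector_derivative, rule \<mu>(2))
  interpret chain n T "\<lambda>k t. fst (\<mu> t) $ \<iota> k" "\<lambda>k t. snd (\<mu> t) $ \<iota> k"
    "\<lambda>k t. if k \<in> {1..<n} then deriv \<phi> (fst (x t) $ \<iota> k - fst (x t) $ \<iota> (k + 1)) else 0"
    by (rule chain_of_adjoint[OF field \<phi>' _ xc \<mu>]) (use assms(7) in auto)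
  define g1 where "g1 t = snd (\<mu> t) $ \<iota> 1" for t
  define gn where "gn t = snd (\<mu> t) $ \<iota> n" for t
  have gc: "continuous_on {0..T} g1" "continuous_on {0..T} gn"
    unfolding g1_def[abs_def] gn_def[abs_def] by (intro continuous_intros \<mu>c)+
  have fin: "finite {t \<in> {0..T}. g1 t = 0}" "finite {t \<in> {0..T}. gn t = 0}"
    unfolding g1_def gn_def by (rule finite_zeros_first finite_zeros_last)+
  \<comment> \<open>Together with \<open>vs\<close> this is the pointwise maximiser of
    \<open>g1 t * r + gn t * s\<close> over the rectangle, unique where neither \<open>g1\<close>
    nor \<open>gn\<close> vanishes. The choice at their zeros affects only finitely many
    times.\<close>
  define us where "us t = (if 0 \<le> g1 t then \<omega> else - \<omega>)" for t
  define vs where "vs t = (if 0 \<le> gn t then 0 else - \<omega>)" for t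
  have sgn_meas: "(\<lambda>t. if 0 \<le> g t then r else s) \<in> borel_measurable (lebesgue_on {0..T})"
    if "continuous_on {0..T} g" for g :: "real \<Rightarrow> real" and r s :: real
  proof -
    have [measurable]: "g \<in> borel_measurable (lebesgue_on {0..T})"
      by (rule continuous_imp_measurable_on_sets_lebesgue[OF that]) simp
    show ?thesis by measurable
  qed
  have "admissible_control \<omega> T us vs"
    unfolding admissible_control_def us_def[abs_def] vs_def[abs_def]
    using sgn_meas gc assms(8) by auto
  then have w: "control (control_set \<omega>) T (\<lambda>t. us t *\<^sub>R dp \<iota> 1 + vs t *\<^sub>R dp \<iota> n)"
    by (rule control_of_admissible)
  \<comment> \<open>Both summands are nonnegative, while the maximum condition tested with
    \<open>(us, vs)\<close> makes the integral nonpositive. Hence each summand vanishes almost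
    everywhere, and away from the zeros of \<open>g1\<close> and \<open>gn\<close> the two controls
    agree.\<close>
  define gap where "gap t = g1 t * (us t - u t) + gn t * (vs t - v t)" for t
  have gap_eq: "\<mu> t \<bullet> (us t *\<^sub>R dp \<iota> 1 + vs t *\<^sub>R dp \<iota> n - h t) = gap t" for t
    by (simp add: gap_def h_def g1_def gn_def inner_diff_right inner_add_right inner_dp algebra_simps)
  have parts: "0 \<le> g1 t * (us t - u t)" "0 \<le> gn t * (vs t - v t)" if "t \<in> {0..T}" for t
  proof -
    have "u t \<in> {-\<omega>..\<omega>}" "v t \<in> {-\<omega>..0}"
      using adm that by (auto simp: admissible_control_def)
    then show "0 \<le> g1 t * (us t - u t)" "0 \<le> gn t * (vs t - v t)"
      by (auto simp: us_def vs_def zero_le_mult_iff)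
  qed
  obtain M where M: "\<And>y. y \<in> control_set \<omega> \<Longrightarrow> norm y \<le> M"
    using bounded_control_set[of \<omega>] unfolding bounded_iff by blast
  have "AE t in lebesgue_on {0..T}. gap t = 0"
  proof (rule nonneg_integral_le_0_imp_AE)
    show "gap integrable_on {0..T}"
      unfolding gap_eq[symmetric, abs_def] inner_diff_right
      by (intro integrable_diff inner_integrable_on[OF \<mu>c, where M = M])
        (use h w M in \<open>auto simp: control_def\<close>)
    show "integral {0..T} gap \<le> 0" using max[OF w] unfolding gap_eq .
  qed (use parts in \<open>auto simp: gap_def\<close>)
  moreover have "AE t in lebesgue_on {0..T}. t \<notin> {t \<in> {0..T}. g1 t = 0} \<union> {t \<in> {0..T}. gn t = 0}"
    using fin by (intro AE_lebesgue_on_not_in_finite) auto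
  moreover have "AE t in lebesgue_on {0..T}. t \<in> {0..T}" by (rule AE_I2) simp
  ultimately have opt: "AE t in lebesgue_on {0..T}. (u t, v t) = (us t, vs t)"
  proof eventually_elim
    case (elim t)
    then have "g1 t * (us t - u t) = 0" "gn t * (vs t - v t) = 0"
      using parts[of t] unfolding gap_def by linarith+
    with elim show ?case by auto
  qed
  have "bang_bang \<omega> T u v"
    unfolding bang_bang_def using opt by eventually_elim (simp add: us_def vs_def)
  moreover have "finitely_many_switchings T u v"
    by (rule sign_control_switchings[OF T gc fin,
          of _ _ "\<lambda>p q. (if p then \<omega> else - \<omega>, if q then 0 else - \<omega>)"])
      (use opt in \<open>simp add: us_def vs_def\<close>)
  ultimately show ?thesis ..
qed

end
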